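(* Let $1\le p<\infty$, let $(\lambda_k)_{k\in\mathbb Z}$ be an admissible sequence of exponents, and let $f\in B\mathcal S^p$ have a Fourier series of the form $\sum_{k\in\mathbb Z}A_k(f)e^{i\lambda_kx}$ of symmetric type with these exponents. Then for any $\tau>0$, $n\in\mathbb N$ and $\varphi\in\Phi$, $$E_{\lambda_n}(f)_p\le C_{n,\varphi,p}(\tau)\,\omega_\varphi\Big(f,\frac{\tau}{\lambda_n}\Big)_p,\qquad(\ast)$$ where $$C_{n,\varphi,p}(\tau):=\Big(\inf_{v\in V(\tau)}\frac{v(\tau)-v(0)}{I_{n,\varphi,p}(\tau,v)}\Big)^{1/p},\qquad I_{n,\varphi,p}(\tau,v):=\inf_{k\in\mathbb N,\,k\ge n}\int_0^\tau\varphi^p\Big(\frac{\lambda_kt}{\lambda_n}\Big)\,dv(t).$$ Furthermore, there exists a function $v_*\in V(\tau)$ that realizes the infimum in the definition of $C_{n,\varphi,p}(\tau)$. Inequality $(\ast)$ is unimprovable on the set of all functions $f\in B\mathcal S^p$ with Fourier series of this form, in the sense that for any $\varphi\in\Phi$ and $n\in\mathbb N$ $$C_{n,\varphi,p}(\tau)=K_{n,\varphi,p}(\tau),\qquad K_{n,\varphi,p}(\tau):=\sup\bigg\{\frac{E_{\lambda_n}(f)_p}{\omega_\varphi(f,\tau/\lambda_n)_p}\bigg\},$$ the supremum being taken over all $f\in B\mathcal S^p$ with Fourier series of this form.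
   Context: Almost periodic functions. A locally Lebesgue integrable $f:\mathbb R\to\mathbb C$ is a $B$-a.p. (Besicovitch almost periodic of order 1) function if there are trigonometric sums $\tau_N$ (finite sums $\sum_j a_je^{i\mu_jx}$, $a_j\in\mathbb C$, $\mu_j\in\mathbb R$) with $\lim_{N\to\infty}\limsup_{T\to\infty}\frac1{2T}\int_{-T}^T|f(x)-\tau_N(x)|\,dx=0$. For such $f$ the mean $M\{f\}=\lim_{T\to\infty}\frac1T\int_0^Tf(x)\,dx$ exists. Put $A_\lambda(f)=M\{f(\cdot)e^{-i\lambda\cdot}\}$, $\lambda\in\mathbb R$; this is nonzero for at most countably many $\lambda$, called the Fourier exponents of $f$. For $1\le p<\infty$, $B\mathcal S^p$ is the space of all $B$-a.p. functions with $\|f\|_p:=\big(\sum_\lambda|A_\lambda(f)|^p\big)^{1/p}<\infty$ (sum over Fourier exponents); functions with the same Fourier series are identified. Symmetric form. Only functions whose Fourier exponents have a single limit point, at infinity, are considered. Their Fourier series is written $\sum_{k\in\mathbb Z}A_ke^{i\lambda_kx}$, $A_k=A_k(f)=M\{f(\cdot)e^{-i\lambda_k\cdot}\}$, where $\lambda_0=0$, $\lambda_{-k}=-\lambda_k$, $\lambda_{k+1}>\lambda_k>0$ and $|A_k|+|A_{-k}|>0$ for $k>0$. A sequence $(\lambda_k)_{k\in\mathbb Z}$ with $\lambda_0=0$, $\lambda_{-k}=-\lambda_k$, $\lambda_{k+1}>\lambda_k>0$ for $k>0$ and $\lambda_k\to\infty$ as $k\to\infty$ is called admissible here. Best approximation.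 $E_{\lambda_n}(f)_p=\inf_{g\in G_{\lambda_n}}\|f-g\|_p$, where $G_{\lambda_n}$ is the set of all $B$-a.p. functions whose Fourier exponents lie in $(-\lambda_n,\lambda_n)$. Generalized modulus of smoothness. $\Phi$ is the set of all continuous nonnegative even functions $\varphi$ on $\mathbb R$ with $\varphi(0)=0$ and such that $\{t\in\mathbb R:\varphi(t)=0\}$ has Lebesgue measure zero. For $\varphi\in\Phi$, $\omega_\varphi(f,\delta)_p=\sup_{|h|\le\delta}\big(\sum_{k\in\mathbb Z}\varphi^p(\lambda_kh)|A_k(f)|^p\big)^{1/p}$, $\delta\ge0$. $V(\tau)$, $\tau>0$, is the set of bounded nondecreasing functions $v$ on $[0,\tau]$ that differ from a constant on $[0,\tau]$; integrals with respect to $dv$ are Stieltjes integrals. Conventions: $0/0=0$; $a/0=+\infty$ for $a>0$. *)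

theory Defs
  imports "HOL-Analysis.Analysis"
begin

definition locally_integrable :: "(real \<Rightarrow> complex) \<Rightarrow> bool" where
  "locally_integrable f \<longleftrightarrow> (\<forall>a b. set_integrable lebesgue {a..b} f)"

definition trig_sum :: "(real \<Rightarrow> complex) \<Rightarrow> bool" where
  "trig_sum \<sigma> \<longleftrightarrow>
     (\<exists>(m::nat) (a :: nat \<Rightarrow> complex) (\<mu> :: nat \<Rightarrow> real).
        \<sigma> = (\<lambda>x. \<Sum>j<m. a j * cis (\<mu> j * x)))"

definition Bap :: "(real \<Rightarrow> complex) \<Rightarrow> bool" where
  "Bap f \<longleftrightarrow> locally_integrable f \<and>
     (\<exists>\<sigma> :: nat \<Rightarrow> real \<Rightarrow> complex. (\<forall>N. trig_sum (\<sigma> N)) \<and>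
        (\<lambda>N. Limsup at_top (\<lambda>T::real. 
            ereal (1 / (2 * T) * (LINT x:{-T..T}|lebesgue. cmod (f x - \<sigma> N x)))))
          \<longlonglongrightarrow> 0)"

definition mean :: "(real \<Rightarrow> complex) \<Rightarrow> complex" where
  "mean f = Lim at_top (\<lambda>T::real. (1 / T) *\<^sub>R (LINT x:{0..T}|lebesgue. f x))"

definition fcoeff :: "(real \<Rightarrow> complex) \<Rightarrow> real \<Rightarrow> complex" where
  "fcoeff f l = mean (\<lambda>x. f x * cis (- (l * x)))"

definition fourier_exponents :: "(real \<Rightarrow> complex) \<Rightarrow> real set" where
  "fourier_exponents f = {l. fcoeff f l \<noteq> 0}"

text \<open>Powers of extended nonnegative reals; only positive exponents are used.\<close>

definition epowr :: "ennreal \<Rightarrow> real \<Rightarrow> ennreal" where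
  "epowr x a = (if x = top then top else ennreal (enn2real x powr a))"

text \<open>The norm takes values in \<open>[0, \<infinity>]\<close>: it is also applied to differences
  \<open>f - g\<close> of almost periodic functions whose coefficients need not be
  \<open>p\<close>-summable.\<close>

definition bs_norm :: "real \<Rightarrow> (real \<Rightarrow> complex) \<Rightarrow> ennreal" where
  "bs_norm p f =
     epowr (\<Sum>\<^sub>\<infinity>l\<in>fourier_exponents f. ennreal (cmod (fcoeff f l) powr p)) (1 / p)"

definition BS :: "real \<Rightarrow> (real \<Rightarrow> complex) set" where
  "BS p = {f. Bap f \<and> bs_norm p f < \<infinity>}"

definition admissible :: "(int \<Rightarrow> real) \<Rightarrow> bool" where
  "admissible lam \<longleftrightarrow>
     lam 0 = 0 \<and> (\<forall>k. lam (- k) = - lam k) \<and>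
     (\<forall>k>0. lam (k + 1) > lam k \<and> lam k > 0) \<and>
     filterlim lam at_top at_top"

definition symmetric_series :: "(int \<Rightarrow> real) \<Rightarrow> (real \<Rightarrow> complex) \<Rightarrow> bool" where
  "symmetric_series lam f \<longleftrightarrow>
     fourier_exponents f \<subseteq> range lam \<and>
     (\<forall>k>0. cmod (fcoeff f (lam k)) + cmod (fcoeff f (lam (- k))) > 0)"

definition BS_sym :: "real \<Rightarrow> (int \<Rightarrow> real) \<Rightarrow> (real \<Rightarrow> complex) set" where
  "BS_sym p lam = {f \<in> BS p. symmetric_series lam f}"

definition G :: "real \<Rightarrow> (real \<Rightarrow> complex) set" where
  "G r = {g. Bap g \<and> fourier_exponents g \<subseteq> {-r<..<r}}"

definition best_approx :: "real \<Rightarrow> real \<Rightarrow> (real \<Rightarrow> complex) \<Rightarrow> ennreal" where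
  "best_approx p r f = (INF g\<in>G r. bs_norm p (\<lambda>x. f x - g x))"

definition Phi :: "(real \<Rightarrow> real) set" where
  "Phi = {\<phi>. continuous_on UNIV \<phi> \<and> (\<forall>t. \<phi> t \<ge> 0) \<and> (\<forall>t. \<phi> (- t) = \<phi> t) \<and>
             \<phi> 0 = 0 \<and> {t. \<phi> t = 0} \<in> null_sets lebesgue}"

definition modulus ::
  "real \<Rightarrow> (int \<Rightarrow> real) \<Rightarrow> (real \<Rightarrow> real) \<Rightarrow> (real \<Rightarrow> complex) \<Rightarrow> real \<Rightarrow> ennreal" where
  "modulus p lam \<phi> f \<delta> =
     (SUP h\<in>{h. \<bar>h\<bar> \<le> \<delta>}.
        epowr (\<Sum>\<^sub>\<infinity>k\<in>UNIV. ennreal (\<phi> (lam k * h) powr p * cmod (fcoeff f (lam k)) powr p))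
              (1 / p))"

text \<open>The Riemann--Stieltjes integral over \<open>[a, b]\<close>: limit, as the mesh tends to
  zero, of the sums over tagged partitions; here \<open>(x, K)\<close> is an interval
  \<open>K = {Inf K..Sup K}\<close> with tag \<open>x \<in> K\<close>. Jumps of \<open>v\<close> at the end points count.\<close>

definition has_RS_integral ::
  "(real \<Rightarrow> real) \<Rightarrow> (real \<Rightarrow> real) \<Rightarrow> real \<Rightarrow> real \<Rightarrow> real \<Rightarrow> bool" where
  "has_RS_integral g v a b I \<longleftrightarrow>
     (\<forall>e>0. \<exists>d>0. \<forall>D. D tagged_division_of {a..b} \<and> (\<lambda>x. ball x d) fine D \<longrightarrow>
        \<bar>(\<Sum>(x, K)\<in>D. g x * (v (Sup K) - v (Inf K))) - I\<bar> < e)"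

definition RS_integral :: "(real \<Rightarrow> real) \<Rightarrow> (real \<Rightarrow> real) \<Rightarrow> real \<Rightarrow> real \<Rightarrow> real" where
  "RS_integral g v a b = (THE I. has_RS_integral g v a b I)"

text \<open>Only the values of \<open>v\<close> on \<open>[0, \<tau>]\<close> matter.\<close>

definition V :: "real \<Rightarrow> (real \<Rightarrow> real) set" where
  "V \<tau> = {v. mono_on {0..\<tau>} v \<and> bounded (v ` {0..\<tau>}) \<and> \<not> v constant_on {0..\<tau>}}"

definition I_const ::
  "real \<Rightarrow> (int \<Rightarrow> real) \<Rightarrow> (real \<Rightarrow> real) \<Rightarrow> nat \<Rightarrow> real \<Rightarrow> (real \<Rightarrow> real) \<Rightarrow> real" where
  "I_const p lam \<phi> n \<tau> v =
     (INF k\<in>{n..}. RS_integral (\<lambda>t. \<phi> (lam (int k) * t / lam (int n)) powr p) v 0 \<tau>)"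

text \<open>Division on \<open>ennreal\<close> satisfies \<open>0 / 0 = 0\<close> and \<open>a / 0 = \<infinity>\<close> for \<open>a > 0\<close>.\<close>

definition V_quotient ::
  "real \<Rightarrow> (int \<Rightarrow> real) \<Rightarrow> (real \<Rightarrow> real) \<Rightarrow> nat \<Rightarrow> real \<Rightarrow> (real \<Rightarrow> real) \<Rightarrow> ennreal" where
  "V_quotient p lam \<phi> n \<tau> v = ennreal (v \<tau> - v 0) / ennreal (I_const p lam \<phi> n \<tau> v)"

definition C_const ::
  "real \<Rightarrow> (int \<Rightarrow> real) \<Rightarrow> (real \<Rightarrow> real) \<Rightarrow> nat \<Rightarrow> real \<Rightarrow> ennreal" where
  "C_const p lam \<phi> n \<tau> = epowr (INF v\<in>V \<tau>. V_quotient p lam \<phi> n \<tau> v) (1 / p)"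

definition K_const ::
  "real \<Rightarrow> (int \<Rightarrow> real) \<Rightarrow> (real \<Rightarrow> real) \<Rightarrow> nat \<Rightarrow> real \<Rightarrow> ennreal" where
  "K_const p lam \<phi> n \<tau> =
     (SUP f\<in>BS_sym p lam.
        best_approx p (lam (int n)) f / modulus p lam \<phi> f (\<tau> / lam (int n)))"

end

theory Submission
  imports Defs
begin

text \<open>
  For \<open>f\<close> in the class put \<open>a\<^sub>k = |A\<^sub>k(f)|\<^sup>p\<close> and
  \<open>\<psi>\<^sub>k(t) = \<phi>\<^sup>p(\<lambda>\<^sub>k t / \<lambda>\<^sub>n)\<close> for \<open>t \<in> [0, \<tau>]\<close>.
  Deleting from \<open>f\<close> the harmonics with \<open>|k| < n\<close> is the best that a competitor in the definition of
  \<open>E\<close> can do, since it cannot touch the other ones; so \<open>E\<^sup>p\<close> is the tail sum of the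
  \<open>a\<^sub>k\<close> over \<open>|k| \<ge> n\<close> (\<open>best_approx_eq\<close>), while \<open>\<omega>\<^sup>p\<close> is
  the supremum over \<open>t\<close> of \<open>\<Sum> a\<^sub>k \<psi>\<^sub>k(t)\<close> (\<open>osc_eq\<close>).
  Almost periodicity enters only through the linearity of the Fourier coefficients and
  the freedom to prescribe them. What remains is a duality between nonnegative sequences \<open>a\<close> and
  monotone functions \<open>v\<close>, that is, measures on \<open>[0, \<tau>]\<close>.

  Weak duality is the inequality itself. Each \<open>k \<ge> n\<close> has \<open>I \<le> \<integral> \<psi>\<^sub>k dv\<close>;
  multiplying by \<open>a\<^sub>k\<close>, summing, and bounding the integrand by \<open>\<omega>\<^sup>p\<close> gives
  \<open>I E\<^sup>p \<le> (v(\<tau>) - v(0)) \<omega>\<^sup>p\<close> (\<open>tail_le_ratio\<close>). The zeros of \<open>\<phi>\<close>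
  form a null set, hence \<open>\<omega> > 0\<close>, and the conventions about \<open>0/0\<close> and \<open>0 \<cdot> \<infinity>\<close>
  do no harm.

  Strong duality, together with the existence of an optimal \<open>v\<close>, is a minimax argument
  (\<open>minimax_sequences\<close>). Let \<open>K\<close> be finite and \<open>m = K\<^sup>-\<^sup>p\<close>. The definition of \<open>K\<close>, applied to
  functions with prescribed coefficients, says that no rapidly decaying weights \<open>b \<ge> 0\<close> and
  \<open>\<epsilon> > 0\<close> satisfy \<open>\<Sum> b\<^sub>k \<psi>\<^sub>k(t) \<le> m \<Sum> b\<^sub>k - \<epsilon>\<close> for all \<open>t\<close>. Consider
  the distribution functions \<open>v\<close> on \<open>[0, \<tau>]\<close>. They form a convex set that is compact for pointwise
  convergence, by Tychonoff, and \<open>v \<mapsto> \<integral> \<psi>\<^sub>k dv\<close> is continuous on it. So the penalty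
  \<open>\<Sum> w\<^sub>k max(0, m - \<integral> \<psi>\<^sub>k dv)\<^sup>2\<close> has a minimiser. Moving the minimiser towards a
  unit point mass cannot decrease the penalty, and the first variation shows that the weights
  \<open>b\<^sub>k = w\<^sub>k max(0, m - \<integral> \<psi>\<^sub>k dv)\<close> would be forbidden weights unless the penalty vanishes.
  Hence \<open>\<integral> \<psi>\<^sub>k dv \<ge> m\<close> for all \<open>k \<ge> n\<close>: this \<open>v\<close> attains the infimum, which is \<open>K\<^sup>p\<close>.
  If \<open>K = \<infinity>\<close>, weak duality makes \<open>(v(\<tau>) - v(0)) / I\<close> infinite for every \<open>v\<close>, and any \<open>v\<close> is optimal.
\<close>

section \<open>The Riemann--Stieltjes integral of a continuous function\<close>

text \<open>
  Tagged divisions of \<open>[a, b]\<close>, directed by mesh size. As a limit along this filter the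
  Riemann--Stieltjes integral inherits uniqueness and linearity from limits in general.
\<close>
definition mesh :: "real \<Rightarrow> real \<Rightarrow> (real \<times> real set) set filter" where
  "mesh a b = (INF d\<in>{0<..}. principal {D. D tagged_division_of {a..b} \<and> (\<lambda>x. ball x d) fine D})"

definition RS_sum :: "(real \<Rightarrow> real) \<Rightarrow> (real \<Rightarrow> real) \<Rightarrow> (real \<times> real set) set \<Rightarrow> real" where
  "RS_sum g v D = (\<Sum>(x, K)\<in>D. g x * (v (Sup K) - v (Inf K)))"

lemma eventually_mesh:
  "eventually P (mesh a b) \<longleftrightarrow>
     (\<exists>d>0. \<forall>D. D tagged_division_of {a..b} \<and> (\<lambda>x. ball x d) fine D \<longrightarrow> P D)"
proof -
  have "eventually P (mesh a b) \<longleftrightarrow>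
      (\<exists>d\<in>{0<..}. eventually P (principal {D. D tagged_division_of {a..b} \<and> (\<lambda>x. ball x d) fine D}))"
    unfolding mesh_def
  proof (rule eventually_INF_base)
    show "\<exists>x\<in>{0<..}. principal {D. D tagged_division_of {a..b} \<and> (\<lambda>z. ball z x) fine D}
        \<le> inf (principal {D. D tagged_division_of {a..b} \<and> (\<lambda>x. ball x d) fine D})
              (principal {D. D tagged_division_of {a..b} \<and> (\<lambda>x. ball x d') fine D})"
      if "d \<in> {0<..}" "d' \<in> {0<..}" for d d' :: real
    proof (rule bexI[of _ "min d d'"])
      have "ball x (min d d') \<subseteq> ball x d" "ball x (min d d') \<subseteq> ball x d'" for x :: real
        by auto
      then show "principal {D. D tagged_division_of {a..b} \<and> (\<lambda>z. ball z (min d d')) fine D}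
        \<le> inf (principal {D. D tagged_division_of {a..b} \<and> (\<lambda>x. ball x d) fine D})
              (principal {D. D tagged_division_of {a..b} \<and> (\<lambda>x. ball x d') fine D})"
        unfolding fine_def inf_principal principal_le_iff by blast
    qed (use that in auto)
  qed auto
  then show ?thesis
    by (auto simp: eventually_principal)
qed

lemma mesh_neq_bot: "mesh a b \<noteq> bot"
proof
  assume "mesh a b = bot"
  then have "eventually (\<lambda>_. False) (mesh a b)" by simp
  then obtain d where d: "d > 0"
    and *: "\<And>D. D tagged_division_of {a..b} \<Longrightarrow> (\<lambda>x. ball x d) fine D \<Longrightarrow> False"
    unfolding eventually_mesh by blast
  show False
    using fine_division_exists_real[of "\<lambda>x. ball x d" a b] d * by (auto simp: gauge_def)
qed

lemma has_RS_integral_iff_tendsto: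
  "has_RS_integral g v a b I \<longleftrightarrow> (RS_sum g v \<longlongrightarrow> I) (mesh a b)"
  unfolding has_RS_integral_def tendsto_iff eventually_mesh RS_sum_def dist_real_def ..

lemma RS_integral_eqI: "has_RS_integral g v a b I \<Longrightarrow> RS_integral g v a b = I"
  unfolding RS_integral_def has_RS_integral_iff_tendsto
  by (rule the_equality) (auto intro: tendsto_unique[OF mesh_neq_bot])

lemma tagged_intervalE:
  fixes a b x :: real
  assumes "D tagged_division_of {a..b}" "(x, K) \<in> D"
  obtains "a \<le> Inf K" "Inf K \<le> x" "x \<le> Sup K" "Sup K \<le> b" "K = {Inf K..Sup K}"
proof -
  note D = tagged_division_ofD(2-4)[OF assms]
  obtain c d where "K = cbox c d" using D(3) by blast
  then have K: "K = {c..d}" by simp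
  with D have "Inf K = c" "Sup K = d" by auto
  with K D show ?thesis by (intro that) auto
qed

text \<open>
  Increments of any \<open>H\<close> over a division telescope, so a local comparison of \<open>g dv\<close> with \<open>dH\<close> on
  each cell adds up to a global one. Used with an indefinite integral for \<open>H\<close> to show existence of the
  integral, and with a step function to integrate against a point mass.
\<close>
lemma RS_sum_close:
  assumes ab: "a \<le> b" and D: "D tagged_division_of {a..b}"
    and close: "\<And>x K. (x, K) \<in> D \<Longrightarrow>
      \<bar>g x * (v (Sup K) - v (Inf K)) - (H (Sup K) - H (Inf K))\<bar> \<le> e * (v (Sup K) - v (Inf K))"
  shows "\<bar>RS_sum g v D - (H b - H a)\<bar> \<le> e * (v b - v a)"
proof -
  have "RS_sum g v D - (H b - H a) =
      (\<Sum>(x, K)\<in>D. g x * (v (Sup K) - v (Inf K)) - (H (Sup K) - H (Inf K)))"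
    unfolding RS_sum_def additive_tagged_division_1[OF ab D, of H, symmetric]
    by (simp add: sum_subtractf case_prod_beta)
  also have "\<bar>\<dots>\<bar> \<le> (\<Sum>(x, K)\<in>D. e * (v (Sup K) - v (Inf K)))"
    using close by (intro order_trans[OF sum_abs] sum_mono) auto
  also have "\<dots> = e * (v b - v a)"
    unfolding additive_tagged_division_1[OF ab D, of v, symmetric]
    by (simp add: sum_distrib_left case_prod_beta)
  finally show ?thesis .
qed

text \<open>
  The generalised inverse of \<open>v\<close>. It turns \<open>\<integral> g dv\<close> into the ordinary integral of
  \<open>g \<circ> quantile\<close> over \<open>[v(a), v(b)]\<close>, which exists without any discussion of
  the jumps of \<open>v\<close>.
\<close>
definition quantile :: "(real \<Rightarrow> real) \<Rightarrow> real \<Rightarrow> real \<Rightarrow> real \<Rightarrow> real" where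
  "quantile v a b u = Inf {x\<in>{a..b}. u \<le> v x}"

text \<open>
  The values of \<open>u\<close> that a cell \<open>[i, s]\<close> contributes are mapped back into the cell. At the left end
  \<open>u = v(i)\<close> this can fail, when \<open>v\<close> is constant to the left of \<open>i\<close>.
\<close>
lemma quantile_between:
  assumes v: "mono_on {a..b} v" and "a \<le> i" "i \<le> s" "s \<le> b" "v i < u" "u \<le> v s"
  shows "quantile v a b u \<in> {i..s}"
proof -
  have "i \<le> x" if "x \<in> {a..b}" "u \<le> v x" for x
  proof (rule ccontr)
    assume "\<not> i \<le> x"
    then have "v x \<le> v i" using assms that by (intro mono_onD[OF v]) auto
    with that assms show False by simp
  qed
  then show ?thesis
    unfolding quantile_def using assms
    by (auto intro!: cInf_greatest cInf_lower bdd_belowI[of _ a] simp: )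
qed

lemma quantile_mono: "mono_on {..v b} (quantile v a b)" if "a \<le> b"
proof (rule mono_onI)
  fix r s assume "r \<in> {..v b}" "s \<in> {..v b}" "r \<le> s"
  then show "quantile v a b r \<le> quantile v a b s"
    unfolding quantile_def using that
    by (intro cInf_superset_mono) (auto intro: bdd_belowI[of _ a] exI[of _ b])
qed

lemma quantile_range: "quantile v a b u \<in> {a..b}" if "a \<le> b" "u \<le> v b"
proof -
  have "b \<in> {x\<in>{a..b}. u \<le> v x}" using that by auto
  then show ?thesis
    unfolding quantile_def
    by (auto intro!: cInf_greatest intro: cInf_lower bdd_belowI[of _ a])
qed

text \<open>
  The quantile is monotone, hence Borel, and takes values in \<open>[a, b]\<close>, where \<open>g\<close> is bounded.
\<close>
lemma integrable_comp_quantile: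
  fixes g :: "real \<Rightarrow> real"
  assumes "a \<le> b" "continuous_on {a..b} g"
  shows "(\<lambda>u. g (quantile v a b u)) integrable_on {v a..v b}"
proof -
  let ?q = "quantile v a b"
  have "mono_on {v a..v b} ?q"
    using quantile_mono[OF assms(1)] by (rule mono_on_subset) auto
  then have q: "?q \<in> borel_measurable (restrict_space borel {v a..v b})"
    by (rule borel_measurable_mono_on_fnc)
  have "?q \<in> measurable (restrict_space borel {v a..v b}) (restrict_space borel {a..b})"
    using q quantile_range[OF assms(1)] by (intro measurable_restrict_space2) auto
  then have "(\<lambda>u. g (?q u)) \<in> borel_measurable (restrict_space borel {v a..v b})"
    using borel_measurable_continuous_on_restrict[OF assms(2)] by (rule measurable_compose)
  then have "(\<lambda>u. indicator {v a..v b} u * g (?q u)) \<in> borel_measurable borel"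
    by (subst (asm) borel_measurable_restrict_space_iff) (auto simp: )
  moreover have "bounded (g ` {a..b})"
    using assms by (intro compact_imp_bounded compact_continuous_image) auto
  then obtain B where B: "\<And>x. x \<in> {a..b} \<Longrightarrow> \<bar>g x\<bar> \<le> B"
    unfolding bounded_iff by (metis image_eqI real_norm_def)
  ultimately have "set_integrable lborel {v a..v b} (\<lambda>u. g (?q u))"
    unfolding set_integrable_def
    using B quantile_range[OF assms(1)]
    by (intro integrableI_bounded_set[where A="{v a..v b}" and B=B]) (auto simp: indicator_def emeasure_lborel_Icc_eq)
  then show ?thesis
    by (rule set_borel_integral_eq_integral)
qed

text \<open>
  The error bound depends on \<open>v\<close> only through its total increment. This uniformity later makes the
  integral a continuous function of \<open>v\<close>.
\<close>
lemma RS_sum_quantile: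
  fixes g :: "real \<Rightarrow> real"
  assumes ab: "a \<le> b" and v: "mono_on {a..b} v" and g: "continuous_on {a..b} g"
    and D: "D tagged_division_of {a..b}"
    and osc: "\<And>x K y. (x, K) \<in> D \<Longrightarrow> y \<in> K \<Longrightarrow> \<bar>g y - g x\<bar> \<le> e"
  shows "\<bar>RS_sum g v D - integral {v a..v b} (\<lambda>u. g (quantile v a b u))\<bar> \<le> e * (v b - v a)"
proof -
  define h where "h u = g (quantile v a b u)" for u
  have h: "h integrable_on {v a..v b}"
    unfolding h_def using ab g by (rule integrable_comp_quantile)
  define H where "H y = integral {v a..v y} h" for y
  have "\<bar>RS_sum g v D - (H b - H a)\<bar> \<le> e * (v b - v a)"
  proof (rule RS_sum_close[OF ab D])
    fix x K assume xK: "(x, K) \<in> D"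
    define i s where "i = Inf K" and "s = Sup K"
    have K: "a \<le> i" "i \<le> x" "x \<le> s" "s \<le> b" "K = {i..s}"
      using tagged_intervalE[OF D xK] unfolding i_def s_def by metis+
    have vs: "v a \<le> v i" "v i \<le> v s" "v s \<le> v b"
      using K by (auto intro!: mono_onD[OF v])
    have sub: "h integrable_on {v i..v s}"
      using h by (rule integrable_on_subinterval) (use vs in auto)
    have "H i + integral {v i..v s} h = H s"
      unfolding H_def using vs
      by (intro Henstock_Kurzweil_Integration.integral_combine integrable_on_subinterval[OF h]) auto
    moreover have "((\<lambda>u. g x - h u) has_integral (g x * (v s - v i) - integral {v i..v s} h)) {v i..v s}"
      using has_integral_diff[OF has_integral_const_real[of "g x" "v i" "v s"] integrable_integral[OF sub]] vs
      by (simp add: mult.commute)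
    then have "norm (g x * (v s - v i) - integral {v i..v s} h) \<le> e * measure lborel {v i..v s}"
    proof (rule has_integral_bound_spike_finite[rotated 2, where S = "{v i}" and a = "v i" and b = "v s", unfolded box_real])
      show "0 \<le> e" using osc[OF xK, of x] K by force
      fix u assume "u \<in> {v i..v s} - {v i}"
      then have "quantile v a b u \<in> {i..s}"
        using K by (intro quantile_between[OF v]) auto
      then show "norm (g x - h u) \<le> e"
        using osc[OF xK, of "quantile v a b u"] K unfolding h_def by (auto simp: abs_minus_commute)
    qed auto
    ultimately show "\<bar>g x * (v (Sup K) - v (Inf K)) - (H (Sup K) - H (Inf K))\<bar> \<le> e * (v (Sup K) - v (Inf K))"
      using vs unfolding i_def[symmetric] s_def[symmetric] by (simp add: algebra_simps)
  qed
  then show ?thesis unfolding H_def h_def by simp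
qed

lemma eventually_mesh_osc:
  fixes g :: "real \<Rightarrow> real"
  assumes "continuous_on {a..b} g" "e > 0"
  shows "eventually (\<lambda>D. D tagged_division_of {a..b} \<and> (\<forall>(x, K)\<in>D. \<forall>y\<in>K. \<bar>g y - g x\<bar> \<le> e)) (mesh a b)"
proof -
  have "uniformly_continuous_on {a..b} g"
    using assms by (intro compact_uniformly_continuous) auto
  then obtain d where d: "d > 0" "\<And>x y. x \<in> {a..b} \<Longrightarrow> y \<in> {a..b} \<Longrightarrow> dist y x < d \<Longrightarrow> dist (g y) (g x) < e"
    using assms(2) unfolding uniformly_continuous_on_def by metis
  have "\<bar>g y - g x\<bar> \<le> e"
    if D: "D tagged_division_of {a..b}" "(\<lambda>x. ball x d) fine D" "(x, K) \<in> D" "y \<in> K" for x y K D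
  proof -
    have "K \<subseteq> ball x d" using that by (auto simp: fine_def)
    then have "dist y x < d" using that by (auto simp: dist_commute)
    moreover have "x \<in> {a..b}" "y \<in> {a..b}"
      using tagged_division_ofD(2,3)[OF D(1,3)] D(4) by auto
    ultimately show ?thesis using d(2)[of x y] by (simp add: dist_real_def)
  qed
  then show ?thesis
    unfolding eventually_mesh using d(1) by (intro exI[of _ d]) auto
qed

lemma has_RS_integral_quantile:
  assumes "a \<le> b" "mono_on {a..b} v" "continuous_on {a..b} g"
  shows "has_RS_integral g v a b (integral {v a..v b} (\<lambda>u. g (quantile v a b u)))"
  unfolding has_RS_integral_iff_tendsto tendsto_iff
proof (intro allI impI)
  fix e :: real assume "e > 0"
  have vab: "v a \<le> v b" using assms by (auto intro!: mono_onD[OF assms(2)])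
  define e' where "e' = e / (v b - v a + 1)"
  have e': "e' > 0" "e' * (v b - v a) < e"
    using \<open>e > 0\<close> vab unfolding e'_def by (auto simp: field_simps)
  show "\<forall>\<^sub>F D in mesh a b. dist (RS_sum g v D) (integral {v a..v b} (\<lambda>u. g (quantile v a b u))) < e"
    using eventually_mesh_osc[OF assms(3) e'(1)]
  proof eventually_elim
    case (elim D)
    then have "\<bar>RS_sum g v D - integral {v a..v b} (\<lambda>u. g (quantile v a b u))\<bar> \<le> e' * (v b - v a)"
      using assms by (intro RS_sum_quantile) auto
    with e' show ?case by (simp add: dist_real_def)
  qed
qed

lemma has_RS_integral_RS_integral:
  assumes "a \<le> b" "mono_on {a..b} v" "continuous_on {a..b} g"
  shows "has_RS_integral g v a b (RS_integral g v a b)"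
  using has_RS_integral_quantile[OF assms] RS_integral_eqI by metis

lemma RS_sum_approx:
  fixes g :: "real \<Rightarrow> real"
  assumes ab: "a \<le> b" and v: "mono_on {a..b} v" and g: "continuous_on {a..b} g"
    and D: "D tagged_division_of {a..b}"
    and osc: "\<And>x K y. (x, K) \<in> D \<Longrightarrow> y \<in> K \<Longrightarrow> \<bar>g y - g x\<bar> \<le> e"
  shows "\<bar>RS_sum g v D - RS_integral g v a b\<bar> \<le> e * (v b - v a)"
  unfolding RS_integral_eqI[OF has_RS_integral_quantile[OF ab v g]]
  using assms by (rule RS_sum_quantile)

lemma RS_integral_sum:
  assumes "a \<le> b" "mono_on {a..b} v" "\<And>i. i \<in> F \<Longrightarrow> continuous_on {a..b} (g i)"
  shows "RS_integral (\<lambda>t. \<Sum>i\<in>F. c i * g i t) v a b = (\<Sum>i\<in>F. c i * RS_integral (g i) v a b)"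
proof (rule RS_integral_eqI)
  have "((\<lambda>D. \<Sum>i\<in>F. c i * RS_sum (g i) v D) \<longlongrightarrow> (\<Sum>i\<in>F. c i * RS_integral (g i) v a b)) (mesh a b)"
    using has_RS_integral_RS_integral[OF assms(1,2) assms(3)]
    by (intro tendsto_sum tendsto_mult_left) (auto simp: has_RS_integral_iff_tendsto)
  moreover have "(\<Sum>i\<in>F. c i * RS_sum (g i) v D) = RS_sum (\<lambda>t. \<Sum>i\<in>F. c i * g i t) v D" for D
    unfolding RS_sum_def
    by (simp add: sum_distrib_left sum_distrib_right case_prod_beta mult.assoc sum.swap[of _ F])
  ultimately show "has_RS_integral (\<lambda>t. \<Sum>i\<in>F. c i * g i t) v a b (\<Sum>i\<in>F. c i * RS_integral (g i) v a b)"
    unfolding has_RS_integral_iff_tendsto by simp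
qed

lemma RS_integral_integrator_linear:
  assumes "a \<le> b" "mono_on {a..b} v" "mono_on {a..b} u" "continuous_on {a..b} g"
  shows "RS_integral g (\<lambda>x. c * v x + d * u x) a b = c * RS_integral g v a b + d * RS_integral g u a b"
proof (rule RS_integral_eqI)
  have "((\<lambda>D. c * RS_sum g v D + d * RS_sum g u D) \<longlongrightarrow>
      c * RS_integral g v a b + d * RS_integral g u a b) (mesh a b)"
    using has_RS_integral_RS_integral[OF assms(1,2,4)] has_RS_integral_RS_integral[OF assms(1,3,4)]
    by (intro tendsto_add tendsto_mult_left) (auto simp: has_RS_integral_iff_tendsto)
  moreover have "c * RS_sum g v D + d * RS_sum g u D = RS_sum g (\<lambda>x. c * v x + d * u x) D" for D
    unfolding RS_sum_def
    by (simp add: sum_distrib_left sum.distrib[symmetric] case_prod_beta algebra_simps)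
  ultimately show "has_RS_integral g (\<lambda>x. c * v x + d * u x) a b (c * RS_integral g v a b + d * RS_integral g u a b)"
    unfolding has_RS_integral_iff_tendsto by simp
qed

lemma RS_integral_mono:
  assumes "a \<le> b" "mono_on {a..b} v" "continuous_on {a..b} g" "continuous_on {a..b} h"
    and "\<And>t. t \<in> {a..b} \<Longrightarrow> g t \<le> h t"
  shows "RS_integral g v a b \<le> RS_integral h v a b"
  unfolding RS_integral_eqI[OF has_RS_integral_quantile[OF assms(1-3)]]
    RS_integral_eqI[OF has_RS_integral_quantile[OF assms(1,2,4)]]
  using assms quantile_range by (intro integral_le integrable_comp_quantile) auto

lemma RS_integral_const:
  assumes "a \<le> b" "mono_on {a..b} v"
  shows "RS_integral (\<lambda>_. c) v a b = c * (v b - v a)"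
  unfolding RS_integral_eqI[OF has_RS_integral_quantile[OF assms continuous_on_const]]
  using assms by (simp add: mono_onD[OF assms(2)])

text \<open>
  A unit jump at \<open>t\<close>. The bound \<open>a < t\<close> matters: a step at \<open>a\<close> would be constant on \<open>[a, b]\<close>.
\<close>
lemma RS_integral_step:
  assumes "a < t" "t \<le> b" "continuous_on {a..b} g"
  shows "RS_integral g (indicator {t..}) a b = g t"
proof (rule RS_integral_eqI)
  let ?v = "indicator {t..} :: real \<Rightarrow> real"
  show "has_RS_integral g ?v a b (g t)"
    unfolding has_RS_integral_iff_tendsto tendsto_iff
  proof (intro allI impI)
    fix e :: real assume "e > 0"
    then have "e/2 > 0" by simp
    from eventually_mesh_osc[OF assms(3) this]
    show "\<forall>\<^sub>F D in mesh a b. dist (RS_sum g ?v D) (g t) < e"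
    proof (eventually_elim)
      case D: (elim D)
      have "\<bar>RS_sum g ?v D - (g t * ?v b - g t * ?v a)\<bar> \<le> e/2 * (?v b - ?v a)"
      proof (rule RS_sum_close)
        fix x K assume xK: "(x, K) \<in> D"
        define i s where "i = Inf K" and "s = Sup K"
        have K: "a \<le> i" "i \<le> x" "x \<le> s" "s \<le> b" "K = {i..s}"
          using tagged_intervalE[OF _ xK] D unfolding i_def s_def by metis+
        have "t \<in> K \<Longrightarrow> \<bar>g t - g x\<bar> \<le> e/2" using D xK by auto
        then show "\<bar>g x * (?v (Sup K) - ?v (Inf K)) - (g t * ?v (Sup K) - g t * ?v (Inf K))\<bar>
            \<le> e/2 * (?v (Sup K) - ?v (Inf K))"
          using K unfolding i_def[symmetric] s_def[symmetric]
          by (auto simp: indicator_def abs_minus_commute)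
      qed (use D assms in auto)
      then show ?case using assms \<open>e > 0\<close> by (simp add: dist_real_def)
    qed
  qed
qed

section \<open>Compactness of the set of distribution functions\<close>

text \<open>
  Fixing the values outside \<open>[0, \<tau>]\<close> makes this a closed subset of a power of \<open>[0, 1]\<close>. There is no
  one-sided continuity requirement, since that would not survive pointwise limits.
\<close>
definition distribution_functions :: "real \<Rightarrow> (real \<Rightarrow> real) set" where
  "distribution_functions \<tau> = {v. mono v \<and> (\<forall>x\<le>0. v x = 0) \<and> (\<forall>x\<ge>\<tau>. v x = 1)}"

lemma compact_distribution_functions:
  assumes "\<tau> > 0"
  shows "compact (distribution_functions \<tau>)"
proof -
  have "compactin (product_topology (\<lambda>_. euclidean) UNIV) (Pi\<^sub>E (UNIV :: real set) (\<lambda>_. {0..1::real}))"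
    unfolding compactin_PiE by auto
  then have "compact (Pi\<^sub>E (UNIV :: real set) (\<lambda>_. {0..1::real}))"
    unfolding euclidean_product_topology by simp
  moreover have "closed (distribution_functions \<tau>)"
    unfolding distribution_functions_def mono_def
    by (intro closed_Collect_conj closed_Collect_all closed_Collect_imp closed_Collect_le closed_Collect_eq
        open_Collect_const continuous_on_product_coordinates continuous_on_const)
  moreover have "distribution_functions \<tau> \<subseteq> Pi\<^sub>E UNIV (\<lambda>_. {0..1})"
  proof
    fix v assume v: "v \<in> distribution_functions \<tau>"
    have "v x \<in> {0..1}" for x
    proof -
      show ?thesis
        using v monoD[of v "min x 0" x] monoD[of v x "max x \<tau>"]
        by (auto simp: distribution_functions_def)
    qed
    then show "v \<in> Pi\<^sub>E UNIV (\<lambda>_. {0..1})" by auto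
  qed
  ultimately show ?thesis
    by (metis closed_Int_compact inf.absorb1)
qed

lemma mono_on_distribution_function: "v \<in> distribution_functions \<tau> \<Longrightarrow> mono_on A v"
  by (auto simp: distribution_functions_def mono_on_def mono_def)

text \<open>
  Each Riemann--Stieltjes sum involves finitely many values of \<open>v\<close>, so it is continuous for pointwise
  convergence; the integral is a limit of such sums that is uniform in \<open>v\<close>.
\<close>
lemma continuous_on_RS_integral:
  assumes "\<tau> > 0" and g: "continuous_on {0..\<tau>} g"
  shows "continuous_on (distribution_functions \<tau>) (\<lambda>v. RS_integral g v 0 \<tau>)"
proof -
  have "\<exists>D. \<forall>v\<in>distribution_functions \<tau>. \<bar>RS_sum g v D - RS_integral g v 0 \<tau>\<bar> \<le> e" if e: "e > 0" for e
  proof -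
    obtain D where D: "D tagged_division_of {0..\<tau>}" "\<forall>(x, K)\<in>D. \<forall>y\<in>K. \<bar>g y - g x\<bar> \<le> e"
      using eventually_happens'[OF mesh_neq_bot eventually_mesh_osc[OF g e]] by blast
    have "\<bar>RS_sum g v D - RS_integral g v 0 \<tau>\<bar> \<le> e * (v \<tau> - v 0)" if "v \<in> distribution_functions \<tau>" for v
      using assms D that by (intro RS_sum_approx mono_on_distribution_function) auto
    then show ?thesis
      by (intro exI[of _ D]) (auto simp: distribution_functions_def)
  qed
  then have "\<exists>D. \<forall>j::nat. \<forall>v\<in>distribution_functions \<tau>. \<bar>RS_sum g v (D j) - RS_integral g v 0 \<tau>\<bar> \<le> 1 / Suc j"
    by (intro choice) auto
  then obtain D where
    D: "\<And>v j. v \<in> distribution_functions \<tau> \<Longrightarrow> \<bar>RS_sum g v (D j) - RS_integral g v 0 \<tau>\<bar> \<le> 1 / Suc j"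
    by blast
  show ?thesis
  proof (rule uniform_limit_theorem)
    show "\<forall>\<^sub>F j in sequentially. continuous_on (distribution_functions \<tau>) (\<lambda>v. RS_sum g v (D j))"
      unfolding RS_sum_def case_prod_beta
      by (intro always_eventually allI continuous_intros
          continuous_on_subset[OF continuous_on_product_coordinates]) auto
    show "uniform_limit (distribution_functions \<tau>) (\<lambda>j v. RS_sum g v (D j)) (\<lambda>v. RS_integral g v 0 \<tau>) sequentially"
    proof (rule uniform_limitI)
      fix e :: real assume "e > 0"
      then have "eventually (\<lambda>j. 1 / Suc j < e) sequentially"
        by (intro order_tendstoD[OF LIMSEQ_Suc[OF lim_1_over_n]])
      then show "\<forall>\<^sub>F j in sequentially. \<forall>v\<in>distribution_functions \<tau>. dist (RS_sum g v (D j)) (RS_integral g v 0 \<tau>) < e"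
        by eventually_elim (use D in \<open>fastforce simp: dist_real_def intro: le_less_trans\<close>)
    qed
  qed simp
qed

section \<open>A minimax theorem for sequences\<close>

text \<open>
  Second order Taylor bound for the penalty \<open>x \<mapsto> max(0, x)\<^sup>2\<close>.
\<close>
lemma max_square_expansion: "(max 0 (a - h))\<^sup>2 \<le> (max 0 a)\<^sup>2 - 2 * max 0 a * h + (h::real)\<^sup>2"
proof (cases "a \<ge> 0")
  case True
  have "(max 0 (a - h))\<^sup>2 \<le> (a - h)\<^sup>2" by (auto simp: max_def)
  with True show ?thesis by (simp add: power2_eq_square algebra_simps)
next
  case False
  then have "(max 0 (a - h))\<^sup>2 \<le> h\<^sup>2"
    by (intro abs_le_square_iff[THEN iffD1]) auto
  with False show ?thesis by simp
qed

text \<open>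
  A minimax theorem for countably many functionals: if every weighted average of the inequalities
  \<open>m \<le> x\<^sub>k\<close> can be satisfied up to \<open>\<epsilon>\<close> in the compact convex set \<open>X\<close>, then all of them can be satisfied
  at once. It suffices to test weights dominated by a fixed summable \<open>w\<close>, because the critical
  weights are the derivative of the penalty \<open>\<Sum> w\<^sub>k max(0, m - x\<^sub>k)\<^sup>2\<close> at its minimiser.
\<close>
lemma minimax_sequences:
  fixes X :: "(nat \<Rightarrow> real) set" and M w :: "nat \<Rightarrow> real"
  assumes X: "compact X" "X \<noteq> {}"
    and bounds: "\<And>x k. x \<in> X \<Longrightarrow> 0 \<le> x k \<and> x k \<le> M k"
    and conv: "\<And>x y s. x \<in> X \<Longrightarrow> y \<in> X \<Longrightarrow> 0 \<le> s \<Longrightarrow> s \<le> 1 \<Longrightarrow> (\<lambda>k. (1 - s) * x k + s * y k) \<in> X"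
    and w: "\<And>k. w k > 0" "summable w" "summable (\<lambda>k. w k * (M k)\<^sup>2)"
    and m: "m \<ge> 0"
    and weighted: "\<And>b e. (\<And>k. 0 \<le> b k \<and> b k \<le> m * w k) \<Longrightarrow> e > 0 \<Longrightarrow>
       \<exists>y\<in>X. m * (\<Sum>k. b k) - e \<le> (\<Sum>k. b k * y k)"
  shows "\<exists>x\<in>X. \<forall>k. m \<le> x k"
proof -
  define F where "F x = (\<Sum>k. w k * (max 0 (m - x k))\<^sup>2)" for x :: "nat \<Rightarrow> real"
  have term_le: "w k * (max 0 (m - x k))\<^sup>2 \<le> w k * m\<^sup>2" if "x \<in> X" for x k
    using bounds[OF that, of k] m w(1)[of k]
    by (intro mult_left_mono power_mono) auto
  have sum_wm: "summable (\<lambda>k. w k * m\<^sup>2)"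
    using w(2) by (rule summable_mult2)
  have sum_F: "summable (\<lambda>k. w k * (max 0 (m - x k))\<^sup>2)" if "x \<in> X" for x
    using term_le[OF that] w(1) by (intro summable_comparison_test'[OF sum_wm, of 0]) (auto simp: less_imp_le)
  have "continuous_on X F"
    unfolding F_def
  proof (rule uniform_limit_theorem)
    show "\<forall>\<^sub>F n in sequentially. continuous_on X (\<lambda>x. \<Sum>k<n. w k * (max 0 (m - x k))\<^sup>2)"
      by (intro always_eventually allI continuous_intros
          continuous_on_subset[OF continuous_on_product_coordinates]) auto
    show "uniform_limit X (\<lambda>n x. \<Sum>k<n. w k * (max 0 (m - x k))\<^sup>2)
        (\<lambda>x. \<Sum>k. w k * (max 0 (m - x k))\<^sup>2) sequentially"
      using term_le w(1) by (intro Weierstrass_m_test[OF _ sum_wm]) (auto simp: less_imp_le)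
  qed simp
  then obtain x where x: "x \<in> X" and min: "\<And>y. y \<in> X \<Longrightarrow> F x \<le> F y"
    using continuous_attains_inf[OF X] by blast
  define b where "b k = w k * max 0 (m - x k)" for k
  have b: "0 \<le> b k \<and> b k \<le> m * w k" for k
    using bounds[OF x, of k] m w(1)[of k] unfolding b_def by (auto intro: mult_left_mono simp: mult.commute[of m])
  have sum_b: "summable b"
    using b by (intro summable_comparison_test'[OF summable_mult[OF w(2), of m], of 0]) auto
  have sum_bx: "summable (\<lambda>k. b k * y k)" if "y \<in> X" for y
  proof (rule summable_comparison_test'[of _ 0])
    show "summable (\<lambda>k. m * (w k + w k * (M k)\<^sup>2))"
      by (intro summable_mult summable_add w)
    fix k
    have "y k \<le> 1 + (M k)\<^sup>2"
    proof -
      have "0 \<le> (M k - 1)\<^sup>2 + (M k)\<^sup>2 + 1" by simp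
      then have "M k \<le> 1 + (M k)\<^sup>2" by (simp add: power2_eq_square algebra_simps)
      then show ?thesis using bounds[OF that, of k] by simp
    qed
    then have "b k * y k \<le> (m * w k) * (1 + (M k)\<^sup>2)"
      using b[of k] bounds[OF that, of k] m w(1)[of k] by (intro mult_mono) auto
    then show "norm (b k * y k) \<le> m * (w k + w k * (M k)\<^sup>2)"
      using b[of k] bounds[OF that, of k] by (simp add: algebra_simps)
  qed
  \<comment> \<open>First order condition at the minimiser in the direction of \<open>y\<close>.\<close>
  have variation: "(\<Sum>k. b k * (y k - x k)) \<le> 0" if y: "y \<in> X" for y
  proof (rule ccontr)
    define P where "P = (\<Sum>k. b k * (y k - x k))"
    define Q where "Q = (\<Sum>k. w k * (y k - x k)\<^sup>2)"
    assume "\<not> (\<Sum>k. b k * (y k - x k)) \<le> 0"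
    then have P: "P > 0" unfolding P_def by simp
    have sum_P: "summable (\<lambda>k. b k * (y k - x k))"
      using summable_diff[OF sum_bx[OF y] sum_bx[OF x]] by (simp add: algebra_simps)
    have sum_Q: "summable (\<lambda>k. w k * (y k - x k)\<^sup>2)"
    proof (rule summable_comparison_test'[OF w(3), of 0])
      fix k
      have "\<bar>y k - x k\<bar> \<le> \<bar>M k\<bar>" using bounds[OF x, of k] bounds[OF y, of k] by auto
      then show "norm (w k * (y k - x k)\<^sup>2) \<le> w k * (M k)\<^sup>2"
        using w(1)[of k] by (auto simp: abs_le_square_iff)
    qed
    have Q: "Q \<ge> 0"
      unfolding Q_def using w(1) by (intro suminf_nonneg sum_Q) (auto simp: less_imp_le)
    have ineq: "2 * P \<le> s * Q" if s: "0 < s" "s \<le> 1" for s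
    proof -
      define z where "z = (\<lambda>k. (1 - s) * x k + s * y k)"
      have z: "z \<in> X" unfolding z_def using s by (intro conv x y) auto
      have "F x \<le> F z" using min[OF z] .
      also have "F z \<le> (\<Sum>k. w k * (max 0 (m - x k))\<^sup>2 - 2 * s * (b k * (y k - x k)) + s\<^sup>2 * (w k * (y k - x k)\<^sup>2))"
        unfolding F_def
      proof (rule suminf_le[OF _ sum_F[OF z]])
        show "summable (\<lambda>k. w k * (max 0 (m - x k))\<^sup>2 - 2 * s * (b k * (y k - x k)) + s\<^sup>2 * (w k * (y k - x k)\<^sup>2))"
          by (intro summable_add summable_diff summable_mult sum_F[OF x] sum_P sum_Q)
        fix k
        have "w k * (max 0 (m - z k))\<^sup>2 \<le> w k * ((max 0 (m - x k))\<^sup>2 - 2 * max 0 (m - x k) * (s * (y k - x k)) + s\<^sup>2 * (y k - x k)\<^sup>2)"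
          unfolding power_mult_distrib[symmetric] using max_square_expansion[of "m - x k" "s * (y k - x k)"] w(1)[of k]
          by (intro mult_left_mono) (auto simp: z_def algebra_simps)
        then show "w k * (max 0 (m - z k))\<^sup>2 \<le> w k * (max 0 (m - x k))\<^sup>2 - 2 * s * (b k * (y k - x k)) + s\<^sup>2 * (w k * (y k - x k)\<^sup>2)"
          unfolding b_def by (simp only: algebra_simps)
      qed
      also have "\<dots> = F x - 2 * s * P + s\<^sup>2 * Q"
        unfolding F_def P_def Q_def
        by (simp add: suminf_add[symmetric] suminf_diff[symmetric] suminf_mult summable_diff
            summable_mult sum_F[OF x] sum_P sum_Q)
      finally have "s * (2 * P) \<le> s * (s * Q)" by (simp add: power2_eq_square algebra_simps)
      then show ?thesis using s by simp
    qed
    \<comment> \<open>A step so short that the quadratic term \<open>s Q\<close> cannot outweigh the linear gain \<open>2 P\<close>.\<close>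
    define s where "s = min 1 (P / (Q + 1))"
    have "s * Q \<le> P / (Q + 1) * Q" unfolding s_def using Q by (intro mult_right_mono) auto
    also have "\<dots> \<le> P" using P Q by (simp add: field_simps)
    finally show False using ineq[of s] P Q by (simp add: s_def)
  qed
  have "m * (\<Sum>k. b k) \<le> (\<Sum>k. b k * x k)"
  proof (rule field_le_epsilon)
    fix e :: real assume "e > 0"
    then obtain y where y: "y \<in> X" "m * (\<Sum>k. b k) - e \<le> (\<Sum>k. b k * y k)"
      using weighted[OF b] by blast
    have "(\<Sum>k. b k * y k) - (\<Sum>k. b k * x k) = (\<Sum>k. b k * (y k - x k))"
      by (simp add: suminf_diff sum_bx x y algebra_simps)
    with variation[OF y(1)] y(2) show "m * (\<Sum>k. b k) \<le> (\<Sum>k. b k * x k) + e" by simp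
  qed
  \<comment> \<open>The slack in the weighted inequality is the penalty itself, so the penalty is at most 0.\<close>
  moreover have "F x = m * (\<Sum>k. b k) - (\<Sum>k. b k * x k)"
  proof -
    have "F x = (\<Sum>k. m * b k - b k * x k)"
      unfolding F_def b_def by (intro suminf_cong) (auto simp: max_def power2_eq_square algebra_simps)
    also have "\<dots> = m * (\<Sum>k. b k) - (\<Sum>k. b k * x k)"
      by (simp add: suminf_diff[symmetric] suminf_mult sum_b sum_bx x summable_mult)
    finally show ?thesis .
  qed
  moreover have "F x \<ge> 0"
    unfolding F_def using w(1) by (intro suminf_nonneg sum_F x) (auto simp: less_imp_le)
  ultimately have "F x = 0" by simp
  then have zero: "w k * (max 0 (m - x k))\<^sup>2 = 0" for k
    unfolding F_def using suminf_eq_zero_iff[OF sum_F[OF x]] w(1) by (auto simp: less_imp_le)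
  have "m \<le> x k" for k
    using zero[of k] w(1)[of k] by (auto simp: max_def split: if_splits)
  with x show ?thesis by blast
qed

section \<open>Means and Fourier coefficients of almost periodic functions\<close>

text \<open>
  The mean as a relation, so that existence of the limit can be carried along with its value.
\<close>
definition has_mean :: "(real \<Rightarrow> complex) \<Rightarrow> complex \<Rightarrow> bool" where
  "has_mean f L \<longleftrightarrow> ((\<lambda>T. (1 / T) *\<^sub>R (LINT x:{0..T}|lebesgue. f x)) \<longlongrightarrow> L) at_top"

lemma mean_eqI: "has_mean f L \<Longrightarrow> mean f = L"
  unfolding has_mean_def mean_def by (rule tendsto_Lim) auto

lemma has_mean_sum:
  assumes "finite J" "\<And>j. j \<in> J \<Longrightarrow> locally_integrable (f j)" "\<And>j. j \<in> J \<Longrightarrow> has_mean (f j) (L j)"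
  shows "has_mean (\<lambda>x. \<Sum>j\<in>J. a j * f j x) (\<Sum>j\<in>J. a j * L j)"
proof -
  have "((\<lambda>T. \<Sum>j\<in>J. a j * ((1 / T) *\<^sub>R (LINT x:{0..T}|lebesgue. f j x))) \<longlongrightarrow> (\<Sum>j\<in>J. a j * L j)) at_top"
    using assms unfolding has_mean_def by (intro tendsto_sum tendsto_mult_left) auto
  moreover have "(LINT x:{0..T}|lebesgue. (\<Sum>j\<in>J. a j * f j x)) = (\<Sum>j\<in>J. a j * (LINT x:{0..T}|lebesgue. f j x))" for T
  proof -
    have "(LINT x:{0..T}|lebesgue. (\<Sum>j\<in>J. a j * f j x)) = (\<Sum>j\<in>J. (LINT x:{0..T}|lebesgue. a j * f j x))"
      using assms(1,2) unfolding locally_integrable_def set_lebesgue_integral_def set_integrable_def scaleR_sum_right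
      by (intro Bochner_Integration.integral_sum) (blast intro: set_integrable_mult_right[unfolded set_integrable_def])
    then show ?thesis by simp
  qed
  ultimately show ?thesis
    unfolding has_mean_def by (simp add: scaleR_sum_right)
qed

lemma has_mean_diff:
  assumes "locally_integrable f" "locally_integrable g" "has_mean f L" "has_mean g M"
  shows "has_mean (\<lambda>x. f x - g x) (L - M)"
proof -
  have "(LINT x:{0..T}|lebesgue. f x - g x) = (LINT x:{0..T}|lebesgue. f x) - (LINT x:{0..T}|lebesgue. g x)" for T
    using assms unfolding locally_integrable_def by (intro set_integral_diff(2)) auto
  then show ?thesis
    using tendsto_diff[OF assms(3,4)[unfolded has_mean_def]]
    unfolding has_mean_def by (simp add: scaleR_diff_right)
qed

lemma locally_integrable_continuous: "continuous_on UNIV f \<Longrightarrow> locally_integrable f"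
  unfolding locally_integrable_def
  by (auto intro: absolutely_integrable_continuous_real continuous_on_subset)

lemma locally_integrable_times_cis:
  assumes "locally_integrable f"
  shows "locally_integrable (\<lambda>x. f x * cis (l * x))"
  unfolding locally_integrable_def
proof (intro allI)
  fix a b
  have f: "set_integrable lebesgue {a..b} f" using assms by (auto simp: locally_integrable_def)
  show "set_integrable lebesgue {a..b} (\<lambda>x. f x * cis (l * x))"
  proof (rule set_integrable_bound[OF f])
    have "(\<lambda>x. cis (l * x)) \<in> borel_measurable borel"
      by (intro borel_measurable_continuous_onI continuous_intros)
    then have "(\<lambda>x. cis (l * x)) \<in> borel_measurable lebesgue"
      by (simp add: measurable_completion)
    moreover have "(\<lambda>x. indicator {a..b} x *\<^sub>R f x) \<in> borel_measurable lebesgue"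
      using f unfolding set_integrable_def by (rule borel_measurable_integrable)
    ultimately have "(\<lambda>x. (indicator {a..b} x *\<^sub>R f x) * cis (l * x)) \<in> borel_measurable lebesgue"
      by measurable
    then show "set_borel_measurable lebesgue {a..b} (\<lambda>x. f x * cis (l * x))"
      unfolding set_borel_measurable_def by simp
  qed (simp add: norm_mult)
qed

lemma has_mean_cis: "has_mean (\<lambda>x. cis (\<mu> * x)) (if \<mu> = 0 then 1 else 0)"
proof -
  have eq: "(LINT x:{0..T}|lebesgue. cis (\<mu> * x)) = integral {0..T} (\<lambda>x. cis (\<mu> * x))" for T
    by (intro set_lebesgue_integral_eq_integral absolutely_integrable_continuous_real continuous_intros)
  show ?thesis
  proof (cases "\<mu> = 0")
    case True
    have "\<forall>\<^sub>F T in at_top. (1 / T) *\<^sub>R (LINT x:{0..T}|lebesgue. cis (\<mu> * x)) = 1"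
      using eventually_gt_at_top[of 0] unfolding eq by eventually_elim (simp add: True of_real_def)
    then show ?thesis
      unfolding has_mean_def using True by (simp add: tendsto_eventually)
  next
    case False
    have int: "integral {0..T} (\<lambda>x. cis (\<mu> * x)) = (cis (\<mu> * T) - 1) / (\<i> * \<mu>)" if "T > 0" for T
    proof -
      have "((\<lambda>x. cis (\<mu> * x)) has_integral (cis (\<mu> * T) / (\<i> * \<mu>) - cis (\<mu> * 0) / (\<i> * \<mu>))) {0..T}"
      proof (rule fundamental_theorem_of_calculus)
        fix x
        have "((\<lambda>z. exp (\<i> * (\<mu> * z)) / (\<i> * \<mu>)) has_field_derivative exp (\<i> * (\<mu> * of_real x))) (at (of_real x))"
          using False by (auto intro!: derivative_eq_intros simp: mult_ac)
        from has_vector_derivative_real_field[OF this, of "{0..T}"]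
        show "((\<lambda>x. cis (\<mu> * x) / (\<i> * \<mu>)) has_vector_derivative cis (\<mu> * x)) (at x within {0..T})"
          by (simp add: cis_conv_exp)
      qed (use that in auto)
      then show ?thesis by (simp add: integral_unique diff_divide_distrib)
    qed
    have "((\<lambda>T. (1 / T) *\<^sub>R (LINT x:{0..T}|lebesgue. cis (\<mu> * x))) \<longlongrightarrow> 0) at_top"
    proof (rule Lim_null_comparison)
      show "\<forall>\<^sub>F T in at_top. norm ((1 / T) *\<^sub>R (LINT x:{0..T}|lebesgue. cis (\<mu> * x))) \<le> (2 / \<bar>\<mu>\<bar>) / T"
        using eventually_gt_at_top[of 0]
      proof eventually_elim
        case (elim T)
        have "norm (cis (\<mu> * T) - 1) \<le> 2"
          by (rule order_trans[OF norm_triangle_ineq4]) simp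
        then have "norm (cis (\<mu> * T) - 1) / \<bar>\<mu>\<bar> / T \<le> 2 / \<bar>\<mu>\<bar> / T"
          using elim False by (intro divide_right_mono) auto
        then show ?case
          unfolding eq int[OF elim] using elim by (simp add: norm_divide norm_mult mult.commute)
      qed
      show "((\<lambda>T. (2 / \<bar>\<mu>\<bar>) / T) \<longlongrightarrow> 0) at_top"
        by (intro tendsto_divide_0[OF tendsto_const] filterlim_at_top_imp_at_infinity filterlim_ident)
    qed
    with False show ?thesis unfolding has_mean_def by simp
  qed
qed

lemma has_mean_trig:
  fixes m :: nat
  shows
  "has_mean (\<lambda>x. (\<Sum>j<m. a j * cis (\<mu> j * x)) * cis (- (l * x))) (\<Sum>j<m. if \<mu> j = l then a j else 0)"
proof -
  have "has_mean (\<lambda>x. \<Sum>j<m. a j * cis ((\<mu> j - l) * x)) (\<Sum>j<m. a j * (if \<mu> j - l = 0 then 1 else 0))"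
    by (intro has_mean_sum has_mean_cis locally_integrable_continuous continuous_intros finite_lessThan)
  moreover have "(\<lambda>x. \<Sum>j<m. a j * cis ((\<mu> j - l) * x)) = (\<lambda>x. (\<Sum>j<m. a j * cis (\<mu> j * x)) * cis (- (l * x)))"
    by (auto simp: sum_distrib_right mult.assoc cis_mult left_diff_distrib)
  moreover have "(\<Sum>j<m. a j * (if \<mu> j - l = 0 then 1 else 0)) = (\<Sum>j<m. if \<mu> j = l then a j else 0)"
    by (intro sum.cong) auto
  ultimately show ?thesis by simp
qed

lemma trig_sum_continuous: "trig_sum \<sigma> \<Longrightarrow> continuous_on UNIV \<sigma>"
  unfolding trig_sum_def by (auto intro!: continuous_intros)

text \<open>
  The factor 2 compares averages over \<open>[0, T]\<close> with the Besicovitch averages over \<open>[-T, T]\<close>.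
\<close>
lemma mean_distance_le:
  assumes f: "locally_integrable f" and g: "locally_integrable g" and T: "T > 0"
  shows "dist ((1 / T) *\<^sub>R (LINT x:{0..T}|lebesgue. f x * cis (l * x)))
              ((1 / T) *\<^sub>R (LINT x:{0..T}|lebesgue. g x * cis (l * x)))
       \<le> 2 * (1 / (2 * T) * (LINT x:{-T..T}|lebesgue. cmod (f x - g x)))"
proof -
  have int: "set_integrable lebesgue {a..b} (\<lambda>x. cmod (f x - g x))" for a b
    using f g unfolding locally_integrable_def
    by (intro set_integrable_norm set_integral_diff(1)) auto
  have fe: "set_integrable lebesgue {a..b} (\<lambda>x. f x * cis (l * x))"
    and ge: "set_integrable lebesgue {a..b} (\<lambda>x. g x * cis (l * x))" for a b
    using f g locally_integrable_times_cis unfolding locally_integrable_def by blast+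
  have "(LINT x:{0..T}|lebesgue. f x * cis (l * x)) - (LINT x:{0..T}|lebesgue. g x * cis (l * x))
      = (LINT x:{0..T}|lebesgue. f x * cis (l * x) - g x * cis (l * x))"
    by (rule set_integral_diff(2)[OF fe ge, symmetric])
  also have "norm \<dots> \<le> (LINT x:{0..T}|lebesgue. cmod (f x * cis (l * x) - g x * cis (l * x)))"
    by (intro set_integral_norm_bound set_integral_diff(1) fe ge)
  also have "\<dots> = (LINT x:{0..T}|lebesgue. cmod (f x - g x))"
    by (simp add: left_diff_distrib[symmetric] norm_mult)
  also have "\<dots> \<le> (LINT x:{-T..T}|lebesgue. cmod (f x - g x))"
    using int T unfolding set_lebesgue_integral_def set_integrable_def
    by (intro integral_mono) (auto simp: indicator_def)
  finally have "cmod ((LINT x:{0..T}|lebesgue. f x * cis (l * x)) - (LINT x:{0..T}|lebesgue. g x * cis (l * x))) / T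
      \<le> (LINT x:{-T..T}|lebesgue. cmod (f x - g x)) / T"
    using T by (intro divide_right_mono) auto
  then show ?thesis
    using T by (simp add: dist_norm scaleR_diff_right[symmetric])
qed

lemma Bap_approx:
  assumes "Bap f" "e > 0"
  obtains \<sigma> where "trig_sum \<sigma>"
    "\<forall>\<^sub>F T in at_top. 1 / (2 * T) * (LINT x:{-T..T}|lebesgue. cmod (f x - \<sigma> x)) < e"
proof -
  obtain \<sigma> where s: "\<And>N. trig_sum (\<sigma> N)" and lim: "(\<lambda>N. Limsup at_top (\<lambda>T::real.
            ereal (1 / (2 * T) * (LINT x:{-T..T}|lebesgue. cmod (f x - \<sigma> N x))))) \<longlonglongrightarrow> 0"
    using assms(1) unfolding Bap_def by blast
  from order_tendstoD(2)[OF lim, of "ereal e"] assms(2)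
  obtain N where "Limsup at_top (\<lambda>T::real.
            ereal (1 / (2 * T) * (LINT x:{-T..T}|lebesgue. cmod (f x - \<sigma> N x)))) < ereal e"
    by (auto simp: eventually_sequentially)
  from Limsup_lessD[OF this] show ?thesis
    by (intro that[of "\<sigma> N"] s) auto
qed

lemma convergent_at_top_if_almost_convergent:
  fixes A :: "real \<Rightarrow> complex"
  assumes "\<And>e. e > 0 \<Longrightarrow> \<exists>L. eventually (\<lambda>T. dist (A T) L < e) at_top"
  shows "\<exists>L. (A \<longlongrightarrow> L) at_top"
proof -
  have "\<exists>L. \<forall>n::nat. eventually (\<lambda>T. dist (A T) (L n) < 1 / Suc n) at_top"
    by (intro choice allI assms) auto
  then obtain L where L: "\<And>n::nat. eventually (\<lambda>T. dist (A T) (L n) < 1 / Suc n) at_top"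
    by blast
  have LL: "dist (L m) (L n) \<le> 1 / Suc m + 1 / Suc n" for m n
  proof -
    obtain T where "dist (A T) (L m) < 1 / Suc m" "dist (A T) (L n) < 1 / Suc n"
      using eventually_happens'[OF _ eventually_conj[OF L[of m] L[of n]]] by auto
    then show ?thesis using dist_triangle3[of "L m" "L n" "A T"] by simp
  qed
  have small: "\<forall>\<^sub>F n in sequentially. 1 / real (Suc n) < e" if "e > 0" for e
    using that by (intro order_tendstoD[OF LIMSEQ_Suc[OF lim_1_over_n]])
  have "Cauchy L"
  proof (rule metric_CauchyI)
    fix e :: real assume "e > 0"
    then obtain N where N: "\<And>n. n \<ge> N \<Longrightarrow> 1 / real (Suc n) < e / 2"
      using small[of "e / 2"] by (auto simp: eventually_sequentially)
    show "\<exists>M. \<forall>m\<ge>M. \<forall>n\<ge>M. dist (L m) (L n) < e"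
    proof (intro exI[of _ N] allI impI)
      fix m n assume "m \<ge> N" "n \<ge> N"
      with LL[of m n] N[of m] N[of n] show "dist (L m) (L n) < e" by linarith
    qed
  qed
  then obtain l where l: "L \<longlonglongrightarrow> l"
    using Cauchy_convergent_iff convergent_def by blast
  have "(A \<longlongrightarrow> l) at_top"
  proof (rule tendstoI)
    fix e :: real assume "e > 0"
    then have "\<forall>\<^sub>F n in sequentially. 1 / real (Suc n) < e / 2 \<and> dist (L n) l < e / 2"
      by (intro eventually_conj small tendstoD[OF l]) auto
    then obtain n where n: "1 / real (Suc n) < e / 2" "dist (L n) l < e / 2"
      using eventually_happens'[OF sequentially_bot] by blast
    show "\<forall>\<^sub>F T in at_top. dist (A T) l < e"
      using L[of n]
    proof eventually_elim
      case (elim T)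
      with n dist_triangle[of "A T" l "L n"] show ?case by linarith
    qed
  qed
  then show ?thesis ..
qed

text \<open>
  Trigonometric sums have means by direct integration, and the averages of \<open>f\<close> are eventually close
  to those of an approximating sum.
\<close>
lemma Bap_has_mean:
  assumes f: "Bap f"
  shows "has_mean (\<lambda>x. f x * cis (- (l * x))) (fcoeff f l)"
proof -
  have loc: "locally_integrable f" using f by (simp add: Bap_def)
  have "\<exists>L. ((\<lambda>T. (1 / T) *\<^sub>R (LINT x:{0..T}|lebesgue. f x * cis (- l * x))) \<longlongrightarrow> L) at_top"
  proof (rule convergent_at_top_if_almost_convergent)
    fix e :: real assume "e > 0"
    then obtain \<sigma> where s: "trig_sum \<sigma>"
      and app: "\<forall>\<^sub>F T in at_top. 1 / (2 * T) * (LINT x:{-T..T}|lebesgue. cmod (f x - \<sigma> x)) < e / 4"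
      using Bap_approx[OF f, of "e / 4"] by auto
    obtain L where "has_mean (\<lambda>x. \<sigma> x * cis (- l * x)) L"
      using s has_mean_trig unfolding trig_sum_def by fastforce
    then have "\<forall>\<^sub>F T in at_top. dist ((1 / T) *\<^sub>R (LINT x:{0..T}|lebesgue. \<sigma> x * cis (- l * x))) L < e / 2"
      unfolding has_mean_def by (rule tendstoD) (use \<open>e > 0\<close> in simp)
    with app eventually_gt_at_top[of 0]
    have "\<forall>\<^sub>F T in at_top. dist ((1 / T) *\<^sub>R (LINT x:{0..T}|lebesgue. f x * cis (- l * x))) L < e"
    proof eventually_elim
      case (elim T)
      have "dist ((1 / T) *\<^sub>R (LINT x:{0..T}|lebesgue. f x * cis (- l * x)))
              ((1 / T) *\<^sub>R (LINT x:{0..T}|lebesgue. \<sigma> x * cis (- l * x)))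
       \<le> 2 * (1 / (2 * T) * (LINT x:{-T..T}|lebesgue. cmod (f x - \<sigma> x)))"
        using s elim by (intro mean_distance_le loc locally_integrable_continuous trig_sum_continuous) auto
      with elim dist_triangle[of "(1 / T) *\<^sub>R (LINT x:{0..T}|lebesgue. f x * cis (- l * x))" L
          "(1 / T) *\<^sub>R (LINT x:{0..T}|lebesgue. \<sigma> x * cis (- l * x))"]
      show ?case by linarith
    qed
    then show "\<exists>L. \<forall>\<^sub>F T in at_top. dist ((1 / T) *\<^sub>R (LINT x:{0..T}|lebesgue. f x * cis (- l * x))) L < e"
      by blast
  qed
  then obtain L where L: "has_mean (\<lambda>x. f x * cis (- (l * x))) L"
    unfolding has_mean_def by auto
  from mean_eqI[OF this] L show ?thesis
    unfolding fcoeff_def by simp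
qed

lemma fcoeff_diff:
  assumes "Bap f" "Bap g"
  shows "fcoeff (\<lambda>x. f x - g x) l = fcoeff f l - fcoeff g l"
proof -
  have "locally_integrable (\<lambda>x. h x * cis (- (l * x)))" if "Bap h" for h
    using that locally_integrable_times_cis[of h "- l"] by (simp add: Bap_def)
  then have "has_mean (\<lambda>x. f x * cis (- (l * x)) - g x * cis (- (l * x))) (fcoeff f l - fcoeff g l)"
    using assms by (intro has_mean_diff Bap_has_mean)
  from mean_eqI[OF this] show ?thesis
    unfolding fcoeff_def by (simp add: left_diff_distrib)
qed

text \<open>
  Absolutely convergent series are the source of all almost periodic functions constructed below: the
  partial sums converge uniformly, so they serve as the approximating sums and coefficients pass to the
  limit. The frequencies may repeat.
\<close>
lemma
  fixes a :: "nat \<Rightarrow> complex" and \<mu> :: "nat \<Rightarrow> real"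
  assumes a: "summable (\<lambda>j. cmod (a j))"
  defines "f \<equiv> \<lambda>x. \<Sum>j. a j * cis (\<mu> j * x)"
  shows Bap_series: "Bap f"
    and fcoeff_series: "fcoeff f l = (\<Sum>j. if \<mu> j = l then a j else 0)"
proof -
  define \<sigma> where "\<sigma> N x = (\<Sum>j<N. a j * cis (\<mu> j * x))" for N x
  define r where "r N = (\<Sum>j. cmod (a (j + N)))" for N
  have r: "r \<longlonglongrightarrow> 0"
    unfolding r_def using suminf_exist_split2[OF a] by simp
  have sm: "summable (\<lambda>j. a j * cis (\<mu> j * x))" for x
    using a by (intro summable_norm_cancel[of "\<lambda>j. a j * cis (\<mu> j * x)"]) (simp add: norm_mult)
  have dist: "cmod (f x - \<sigma> N x) \<le> r N" for N x
  proof -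
    have "f x - \<sigma> N x = (\<Sum>j. a (j + N) * cis (\<mu> (j + N) * x))"
      unfolding f_def \<sigma>_def suminf_split_initial_segment[OF sm, of x N] by simp
    also have "cmod \<dots> \<le> (\<Sum>j. cmod (a (j + N) * cis (\<mu> (j + N) * x)))"
      using summable_ignore_initial_segment[OF a, of N] by (intro summable_norm) (simp add: norm_mult)
    finally show ?thesis unfolding r_def by (simp add: norm_mult)
  qed
  have trig: "trig_sum (\<sigma> N)" for N
    unfolding trig_sum_def \<sigma>_def by blast
  have "continuous_on UNIV f"
  proof (rule uniform_limit_theorem)
    show "\<forall>\<^sub>F N in sequentially. continuous_on UNIV (\<sigma> N)"
      using trig by (intro always_eventually allI trig_sum_continuous)
    show "uniform_limit UNIV \<sigma> f sequentially"
      unfolding \<sigma>_def f_def using a by (intro Weierstrass_m_test) (auto simp: norm_mult)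
  qed simp
  then have loc: "locally_integrable f"
    by (rule locally_integrable_continuous)
  have locs: "locally_integrable (\<sigma> N)" for N
    using trig by (intro locally_integrable_continuous trig_sum_continuous)
  have avg: "1 / (2 * T) * (LINT x:{-T..T}|lebesgue. cmod (f x - \<sigma> N x)) \<le> r N" if T: "T > 0" for N T
  proof -
    have "set_integrable lebesgue {-T..T} (\<lambda>x. cmod (f x - \<sigma> N x))"
      using loc locs unfolding locally_integrable_def
      by (intro set_integrable_norm set_integral_diff(1)) auto
    moreover have "set_integrable lebesgue {-T..T} (\<lambda>x. r N)"
      by (intro absolutely_integrable_continuous_real continuous_on_const)
    ultimately have "(LINT x:{-T..T}|lebesgue. cmod (f x - \<sigma> N x)) \<le> (LINT x:{-T..T}|lebesgue. r N)"
      using dist by (rule set_integral_mono)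
    also have "\<dots> = 2 * T * r N"
      using T by (simp add: set_lebesgue_integral_def)
    finally have "(LINT x:{-T..T}|lebesgue. cmod (f x - \<sigma> N x)) / (2 * T) \<le> r N"
      using T by (simp add: pos_divide_le_eq mult.commute)
    then show ?thesis by simp
  qed
  show f: "Bap f"
    unfolding Bap_def
  proof (intro conjI loc exI[of _ \<sigma>] allI trig)
    let ?A = "\<lambda>N T. ereal (1 / (2 * T) * (LINT x:{-T..T}|lebesgue. cmod (f x - \<sigma> N x)))"
    show "(\<lambda>N. Limsup at_top (?A N)) \<longlonglongrightarrow> 0"
    proof (rule tendsto_sandwich)
      have upper: "\<forall>\<^sub>F T in at_top. ?A N T \<le> ereal (r N)" for N
        using eventually_gt_at_top[of 0]
      proof eventually_elim
        case (elim T)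
        from avg[OF elim, of N] show ?case unfolding ereal_less_eq .
      qed
      show "\<forall>\<^sub>F N in sequentially. Limsup at_top (?A N) \<le> ereal (r N)"
        by (intro always_eventually allI Limsup_bounded upper)
      have lower: "\<forall>\<^sub>F T in at_top. 0 \<le> ?A N T" for N
        using eventually_gt_at_top[of 0]
      proof eventually_elim
        case (elim T)
        have "0 \<le> (LINT x:{-T..T}|lebesgue. cmod (f x - \<sigma> N x))"
          unfolding set_lebesgue_integral_def by (rule integral_nonneg_AE) auto
        with elim show ?case by simp
      qed
      show "\<forall>\<^sub>F N in sequentially. 0 \<le> Limsup at_top (?A N)"
        by (intro always_eventually allI le_Limsup lower) simp
      show "(\<lambda>N. ereal (r N)) \<longlonglongrightarrow> 0"
        using r by (simp add: zero_ereal_def)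
    qed simp
  qed
  have "dist (fcoeff f l) (\<Sum>j<N. if \<mu> j = l then a j else 0) \<le> 2 * r N" for N
  proof (rule tendsto_upperbound)
    let ?m = "\<lambda>h T. (1 / T) *\<^sub>R (LINT x:{0..T}|lebesgue. h x * cis (- (l * x)))"
    show "((\<lambda>T. dist (?m f T) (?m (\<sigma> N) T)) \<longlongrightarrow> dist (fcoeff f l) (\<Sum>j<N. if \<mu> j = l then a j else 0)) at_top"
      using Bap_has_mean[OF f, of l] has_mean_trig[where m = N and a = a and \<mu> = \<mu> and l = l] unfolding has_mean_def \<sigma>_def
      by (rule tendsto_dist)
    show "\<forall>\<^sub>F T in at_top. dist (?m f T) (?m (\<sigma> N) T) \<le> 2 * r N"
      using eventually_gt_at_top[of 0]
    proof eventually_elim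
      case (elim T)
      with mean_distance_le[OF loc locs[of N], of T "- l"] avg[of T N] show ?case by simp
    qed
  qed simp
  then have "\<forall>\<^sub>F N in sequentially. norm ((\<Sum>j<N. if \<mu> j = l then a j else 0) - fcoeff f l) \<le> 2 * r N"
    by (intro always_eventually allI) (simp add: dist_norm norm_minus_commute)
  from Lim_null_comparison[OF this tendsto_mult_right_zero[OF r]]
  have "(\<lambda>N. \<Sum>j<N. if \<mu> j = l then a j else 0) \<longlonglongrightarrow> fcoeff f l"
    by (rule LIM_zero_cancel)
  then show "fcoeff f l = (\<Sum>j. if \<mu> j = l then a j else 0)"
    by (intro sums_unique) (simp add: sums_def)
qed

lemma
  fixes a :: "nat \<Rightarrow> complex" and \<mu> :: "nat \<Rightarrow> real"
  assumes a: "summable (\<lambda>j. cmod (a j))" and \<mu>: "inj \<mu>"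
  defines "f \<equiv> \<lambda>x. \<Sum>j. a j * cis (\<mu> j * x)"
  shows fcoeff_series_exponent: "fcoeff f (\<mu> i) = a i"
    and fcoeff_series_other: "l \<notin> range \<mu> \<Longrightarrow> fcoeff f l = 0"
proof -
  have "(\<Sum>j. if \<mu> j = \<mu> i then a j else 0) = (\<Sum>j. if j = i then a j else 0)"
    using \<mu> by (simp add: inj_eq)
  then show "fcoeff f (\<mu> i) = a i"
    unfolding f_def fcoeff_series[OF a] by (simp add: sums_unique[OF sums_single, symmetric])
  show "fcoeff f l = 0" if "l \<notin> range \<mu>"
  proof -
    have "(\<lambda>j. if \<mu> j = l then a j else 0) = (\<lambda>_. 0)"
      using that by (intro ext) auto
    then show ?thesis unfolding f_def fcoeff_series[OF a] by simp
  qed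
qed

section \<open>Powers and sums of extended nonnegative reals\<close>

lemma epowr_mono: "x \<le> y \<Longrightarrow> a > 0 \<Longrightarrow> epowr x a \<le> epowr y a"
  unfolding epowr_def
  by (auto simp: top_unique enn2real_mono top.not_eq_extremum intro!: ennreal_leI powr_mono2)

lemma epowr_ennreal: "x \<ge> 0 \<Longrightarrow> epowr (ennreal x) a = ennreal (x powr a)"
  by (simp add: epowr_def)

lemma epowr_top [simp]: "epowr top a = top"
  by (simp add: epowr_def)

lemma epowr_zero [simp]: "epowr 0 a = 0"
  by (simp add: epowr_def)

lemma epowr_epowr_inverse:
  assumes "a > 0"
  shows "epowr (epowr x a) (1 / a) = x" "epowr (epowr x (1 / a)) a = x"
  using assms by (cases x; simp add: epowr_ennreal powr_powr)+

lemma epowr_mult: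
  assumes "a > 0"
  shows "epowr (x * y) a = epowr x a * epowr y a"
proof -
  have top: "epowr (top * z) a = top * epowr z a" for z
    using assms by (cases z) (auto simp: ennreal_top_mult epowr_ennreal)
  show ?thesis
    using top[of x] top[of y]
    by (cases x; cases y) (auto simp: epowr_ennreal powr_mult mult.commute simp flip: ennreal_mult)
qed

lemma epowr_divide:
  assumes "a > 0"
  shows "epowr (x / y) a = epowr x a / epowr y a"
proof -
  have "epowr (inverse y) a = inverse (epowr y a)"
  proof (cases y)
    case (real r)
    then show ?thesis
      using assms by (cases "r = 0") (auto simp: inverse_ennreal epowr_ennreal inverse_powr)
  qed simp
  then show ?thesis
    unfolding divide_ennreal_def using assms by (simp add: epowr_mult)
qed

text \<open>
  Powers are order isomorphisms of \<open>[0, \<infinity>]\<close>; therefore \<open>p\<close>-th roots commute with the suprema in the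
  modulus and in \<open>K\<close>, and the whole theorem can be stated for \<open>p\<close>-th powers.
\<close>
lemma epowr_le_iff:
  assumes "a > 0"
  shows "epowr x a \<le> y \<longleftrightarrow> x \<le> epowr y (1 / a)"
  using assms epowr_mono[of "epowr x a" y "1 / a"] epowr_mono[of x "epowr y (1 / a)" a]
  by (auto simp: epowr_epowr_inverse)

lemma epowr_SUP:
  assumes "a > 0"
  shows "epowr (SUP i\<in>A. f i) a = (SUP i\<in>A. epowr (f i) a)"
proof (rule antisym)
  show "epowr (SUP i\<in>A. f i) a \<le> (SUP i\<in>A. epowr (f i) a)"
    unfolding epowr_le_iff[OF assms]
    by (intro SUP_least) (auto simp: epowr_le_iff[OF assms, symmetric] intro: SUP_upper)
qed (use assms in \<open>intro SUP_least epowr_mono SUP_upper\<close>)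

lemma infsum_le_ennreal:
  fixes f :: "'a \<Rightarrow> ennreal"
  assumes "\<And>F. finite F \<Longrightarrow> F \<subseteq> A \<Longrightarrow> sum f F \<le> c"
  shows "infsum f A \<le> c"
  unfolding nonneg_infsum_complete[of A f, OF zero_le]
  using assms by (intro SUP_least) auto

lemma sum_le_infsum_ennreal:
  fixes f :: "'a \<Rightarrow> ennreal"
  assumes "finite F" "F \<subseteq> A"
  shows "sum f F \<le> infsum f A"
  unfolding nonneg_infsum_complete[of A f, OF zero_le]
  using assms by (intro SUP_upper) auto

section \<open>Best approximation as a tail sum\<close>

lemma admissible_strict_mono:
  assumes "admissible lam"
  shows "strict_mono lam"
proof -
  have lam: "lam 0 = 0" "\<And>k. lam (- k) = - lam k" "\<And>k. k > 0 \<Longrightarrow> lam k < lam (k + 1)" "\<And>k. k > 0 \<Longrightarrow> 0 < lam k"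
    using assms by (auto simp: admissible_def)
  have step: "lam k < lam (k + 1)" for k
  proof -
    consider "k > 0" | "k = 0" | "k = -1" | "- k - 1 > 0" by linarith
    then show ?thesis
    proof cases
      case 4
      from lam(3)[OF this] lam(2)[of k] lam(2)[of "k + 1"] show ?thesis by simp
    qed (use lam(1,3) lam(4)[of 1] lam(2)[of 1] in auto)
  qed
  show ?thesis
  proof (rule strict_monoI)
    fix i j :: int assume "i < j"
    then show "lam i < lam j"
      by (induction rule: int_gr_induct) (use step less_trans in blast)+
  qed
qed

text \<open>
  The \<open>p\<close>-th power of the best approximation, by the lemma that follows.
\<close>
definition tail_sum :: "real \<Rightarrow> (int \<Rightarrow> real) \<Rightarrow> nat \<Rightarrow> (real \<Rightarrow> complex) \<Rightarrow> ennreal" where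
  "tail_sum p lam n f = (\<Sum>\<^sub>\<infinity>k\<in>{k. int n \<le> \<bar>k\<bar>}. ennreal (cmod (fcoeff f (lam k)) powr p))"

text \<open>
  A function with exponents in \<open>(-\<lambda>\<^sub>n, \<lambda>\<^sub>n)\<close> leaves the coefficients with \<open>|k| \<ge> n\<close>
  unchanged, which gives the lower bound; the partial sum of the Fourier series over \<open>|k| < n\<close>
  cancels all others and gives the upper bound.
\<close>
lemma best_approx_eq:
  assumes p: "p \<ge> 1" and lam: "admissible lam" and n: "n \<ge> 1"
    and f: "Bap f" "fourier_exponents f \<subseteq> range lam"
  shows "best_approx p (lam (int n)) f = epowr (tail_sum p lam n f) (1 / p)"
proof -
  note mono = admissible_strict_mono[OF lam]
  have inj: "inj lam" using mono by (rule strict_mono_imp_inj_on)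
  have sym: "lam (- k) = - lam k" for k using lam by (auto simp: admissible_def)
  have mem: "lam k \<in> {- lam (int n)<..<lam (int n)} \<longleftrightarrow> \<bar>k\<bar> < int n" for k
    using strict_mono_less[OF mono, of "- int n" k] strict_mono_less[OF mono, of k "int n"] sym[of "int n"]
    by auto
  let ?T = "{k. int n \<le> \<bar>k\<bar>}"
  let ?S = "\<lambda>h A. \<Sum>\<^sub>\<infinity>l\<in>A. ennreal (cmod (fcoeff h l) powr p)"
  have tail_sum: "tail_sum p lam n f = ?S f (lam ` ?T)"
    unfolding tail_sum_def using inj
    by (subst infsum_reindex) (auto simp: o_def intro: inj_on_subset)
  have "tail_sum p lam n f \<le> ?S (\<lambda>x. f x - g x) (fourier_exponents (\<lambda>x. f x - g x))"
    if g: "g \<in> G (lam (int n))" for g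
    unfolding tail_sum
  proof (rule infsum_mono_neutral)
    fix l assume "l \<in> lam ` ?T \<inter> fourier_exponents (\<lambda>x. f x - g x)"
    then have "fcoeff g l = 0"
      using g mem unfolding G_def fourier_exponents_def by fastforce
    then show "ennreal (cmod (fcoeff f l) powr p) \<le> ennreal (cmod (fcoeff (\<lambda>x. f x - g x) l) powr p)"
      using f g by (simp add: fcoeff_diff G_def)
  next
    fix l assume l: "l \<in> lam ` ?T - fourier_exponents (\<lambda>x. f x - g x)"
    then have "fcoeff g l = 0"
      using g mem unfolding G_def fourier_exponents_def by fastforce
    with l show "ennreal (cmod (fcoeff f l) powr p) \<le> 0"
      using f g by (simp add: fcoeff_diff G_def fourier_exponents_def)
  qed (auto intro: nonneg_summable_on_complete)
  then have "epowr (tail_sum p lam n f) (1 / p) \<le> best_approx p (lam (int n)) f"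
    unfolding best_approx_def bs_norm_def using p by (intro INF_greatest epowr_mono) auto
  moreover have "best_approx p (lam (int n)) f \<le> epowr (tail_sum p lam n f) (1 / p)"
  proof -
    \<comment> \<open>The indices \<open>-n < k < n\<close> are enumerated as \<open>j - n + 1\<close> with \<open>j < 2 n - 1\<close>.\<close>
    define \<mu> where "\<mu> j = lam (int j - int n + 1)" for j :: nat
    define a where "a j = (if j < 2 * n - 1 then fcoeff f (\<mu> j) else 0)" for j
    define g where "g = (\<lambda>x. \<Sum>j. a j * cis (\<mu> j * x))"
    have a: "summable (\<lambda>j. cmod (a j))"
      by (rule summable_finite[of "{..<2 * n - 1}"]) (auto simp: a_def)
    have \<mu>: "inj \<mu>"
      unfolding \<mu>_def by (intro injI) (auto dest!: injD[OF inj])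
    have low: "fcoeff g (lam k) = fcoeff f (lam k)" if "\<bar>k\<bar> < int n" for k
    proof -
      define j where "j = nat (k + int n - 1)"
      have j: "\<mu> j = lam k" "j < 2 * n - 1"
        using that n unfolding \<mu>_def j_def by auto
      then show ?thesis
        using fcoeff_series_exponent[OF a \<mu>, of j] unfolding g_def by (simp add: a_def)
    qed
    have high: "fcoeff g l = 0" if "l \<notin> lam ` {k. \<bar>k\<bar> < int n}" for l
    proof (cases "l \<in> range \<mu>")
      case True
      then obtain j where j: "l = \<mu> j" by auto
      have "j \<ge> 2 * n - 1"
        using that n unfolding j \<mu>_def by force
      then show ?thesis
        using fcoeff_series_exponent[OF a \<mu>, of j] unfolding g_def j by (simp add: a_def)
    next
      case False
      then show ?thesis using fcoeff_series_other[OF a \<mu>] unfolding g_def by simp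
    qed
    have g: "g \<in> G (lam (int n))"
      unfolding G_def
    proof (intro CollectI conjI subsetI)
      show "Bap g" unfolding g_def using a by (rule Bap_series)
      fix l assume "l \<in> fourier_exponents g"
      then have "l \<in> lam ` {k. \<bar>k\<bar> < int n}" using high by (auto simp: fourier_exponents_def)
      then show "l \<in> {- lam (int n)<..<lam (int n)}" using mem by blast
    qed
    have "?S (\<lambda>x. f x - g x) (fourier_exponents (\<lambda>x. f x - g x)) \<le> tail_sum p lam n f"
      unfolding tail_sum
    proof (rule infsum_mono_neutral)
      fix l assume "l \<in> fourier_exponents (\<lambda>x. f x - g x) \<inter> lam ` ?T"
      then have "l \<notin> lam ` {k. \<bar>k\<bar> < int n}"
        using inj by (auto dest: injD)
      from high[OF this] show "ennreal (cmod (fcoeff (\<lambda>x. f x - g x) l) powr p) \<le> ennreal (cmod (fcoeff f l) powr p)"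
        using f g by (simp add: fcoeff_diff G_def)
    next
      fix l assume l: "l \<in> fourier_exponents (\<lambda>x. f x - g x) - lam ` ?T"
      have "fcoeff f l - fcoeff g l \<noteq> 0"
        using l f g by (simp add: fcoeff_diff G_def fourier_exponents_def)
      then have "fcoeff f l \<noteq> 0 \<or> fcoeff g l \<noteq> 0" by auto
      then have "l \<in> range lam"
        using f(2) high unfolding fourier_exponents_def by blast
      then obtain k where k: "l = lam k" by blast
      then have "\<bar>k\<bar> < int n" using l by (auto simp: image_iff not_le)
      with k low \<open>fcoeff f l - fcoeff g l \<noteq> 0\<close>
      show "ennreal (cmod (fcoeff (\<lambda>x. f x - g x) l) powr p) \<le> 0" by simp
    qed (auto intro: nonneg_summable_on_complete)
    then have "bs_norm p (\<lambda>x. f x - g x) \<le> epowr (tail_sum p lam n f) (1 / p)"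
      unfolding bs_norm_def using p by (intro epowr_mono) auto
    then show ?thesis
      unfolding best_approx_def using g by (rule INF_lower2[rotated])
  qed
  ultimately show ?thesis by (rule antisym[rotated])
qed

section \<open>Weak duality\<close>

text \<open>
  The \<open>p\<close>-th power of the modulus of smoothness.
\<close>
definition oscillation_sum :: "real \<Rightarrow> (int \<Rightarrow> real) \<Rightarrow> (real \<Rightarrow> real) \<Rightarrow> (real \<Rightarrow> complex) \<Rightarrow> real \<Rightarrow> ennreal" where
  "oscillation_sum p lam \<phi> f \<delta> = (SUP h\<in>{h. \<bar>h\<bar> \<le> \<delta>}.
     \<Sum>\<^sub>\<infinity>k\<in>UNIV. ennreal (\<phi> (lam k * h) powr p * cmod (fcoeff f (lam k)) powr p))"

lemma modulus_eq: "p > 0 \<Longrightarrow> modulus p lam \<phi> f \<delta> = epowr (oscillation_sum p lam \<phi> f \<delta>) (1 / p)"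
  unfolding modulus_def oscillation_sum_def by (subst epowr_SUP) auto

locale smoothness_setting =
  fixes p \<tau> :: real and lam :: "int \<Rightarrow> real" and n :: nat and \<phi> :: "real \<Rightarrow> real"
  assumes p: "1 \<le> p" and lam: "admissible lam" and \<tau>: "\<tau> > 0" and n: "n \<ge> 1" and \<phi>: "\<phi> \<in> Phi"
begin

definition \<psi> :: "int \<Rightarrow> real \<Rightarrow> real" where
  "\<psi> k t = \<phi> (lam k * t / lam (int n)) powr p"

abbreviation tail :: "(real \<Rightarrow> complex) \<Rightarrow> ennreal" where
  "tail \<equiv> tail_sum p lam n"

abbreviation osc :: "(real \<Rightarrow> complex) \<Rightarrow> ennreal" where
  "osc f \<equiv> oscillation_sum p lam \<phi> f (\<tau> / lam (int n))"

abbreviation ratio :: "(real \<Rightarrow> real) \<Rightarrow> ennreal" where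
  "ratio \<equiv> V_quotient p lam \<phi> n \<tau>"

lemma lam_minus: "lam (- k) = - lam k" and lam_pos: "k > 0 \<Longrightarrow> lam k > 0" and lam_n: "lam (int n) > 0"
  using lam n by (auto simp: admissible_def)

lemma lam_inj: "inj lam"
  using admissible_strict_mono[OF lam] by (rule strict_mono_imp_inj_on)

lemma phi_even: "\<phi> (- t) = \<phi> t" and phi_zero: "\<phi> 0 = 0"
  using \<phi> by (auto simp: Phi_def)

lemma psi_nonneg: "\<psi> k t \<ge> 0"
  by (simp add: \<psi>_def)

lemma psi_zero: "\<psi> k 0 = 0"
  by (simp add: \<psi>_def phi_zero)

lemma psi_abs: "\<psi> \<bar>k\<bar> t = \<psi> k t"
  using phi_even[of "lam k * t / lam (int n)"] by (simp add: \<psi>_def abs_if lam_minus)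

lemma psi_continuous: "continuous_on A (\<psi> k)"
proof -
  have c: "continuous_on UNIV \<phi>" and nn: "\<phi> t \<ge> 0" for t using \<phi> by (auto simp: Phi_def)
  have "continuous_on A (\<lambda>t. \<phi> (lam k * t / lam (int n)))"
    using lam_n by (intro continuous_on_compose2[OF c] continuous_intros) auto
  then show ?thesis
    unfolding \<psi>_def using nn p by (intro continuous_on_powr') (auto intro: continuous_on_const)
qed

lemma psi_bounded: "\<exists>B. \<forall>t\<in>{0..\<tau>}. \<psi> k t \<le> B"
proof -
  have "compact (\<psi> k ` {0..\<tau>})"
    using psi_continuous by (intro compact_continuous_image) auto
  from bounded_imp_bdd_above[OF compact_imp_bounded[OF this]] show ?thesis
    by (auto simp: bdd_above_def)
qed

text \<open>
  The substitution \<open>t = \<lambda>\<^sub>n |h|\<close>; negative \<open>h\<close> contribute nothing new because \<open>\<phi>\<close> is even.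
\<close>
lemma osc_eq: "osc f = (SUP t\<in>{0..\<tau>}. \<Sum>\<^sub>\<infinity>k\<in>UNIV. ennreal (\<psi> k t * cmod (fcoeff f (lam k)) powr p))"
  unfolding oscillation_sum_def
proof (rule SUP_eq)
  fix h assume h: "h \<in> {h. \<bar>h\<bar> \<le> \<tau> / lam (int n)}"
  have "\<phi> (lam k * h) powr p = \<psi> k (lam (int n) * \<bar>h\<bar>)" for k
    using lam_n phi_even[of "lam k * h"] by (simp add: \<psi>_def abs_if)
  moreover have "lam (int n) * \<bar>h\<bar> \<in> {0..\<tau>}"
    using h lam_n by (simp add: field_simps)
  ultimately show "\<exists>t\<in>{0..\<tau>}. (\<Sum>\<^sub>\<infinity>k\<in>UNIV. ennreal (\<phi> (lam k * h) powr p * cmod (fcoeff f (lam k)) powr p))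
      \<le> (\<Sum>\<^sub>\<infinity>k\<in>UNIV. ennreal (\<psi> k t * cmod (fcoeff f (lam k)) powr p))"
    by (intro bexI[of _ "lam (int n) * \<bar>h\<bar>"]) simp_all
next
  fix t assume "t \<in> {0..\<tau>}"
  then have "t / lam (int n) \<in> {h. \<bar>h\<bar> \<le> \<tau> / lam (int n)}"
    using lam_n by (simp add: divide_right_mono)
  then show "\<exists>h\<in>{h. \<bar>h\<bar> \<le> \<tau> / lam (int n)}. (\<Sum>\<^sub>\<infinity>k\<in>UNIV. ennreal (\<psi> k t * cmod (fcoeff f (lam k)) powr p))
      \<le> (\<Sum>\<^sub>\<infinity>k\<in>UNIV. ennreal (\<phi> (lam k * h) powr p * cmod (fcoeff f (lam k)) powr p))"
    by (intro bexI[of _ "t / lam (int n)"]) (auto simp: \<psi>_def)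
qed

lemma osc_ge:
  assumes "t \<in> {0..\<tau>}" "finite F"
  shows "ennreal (\<Sum>k\<in>F. \<psi> k t * cmod (fcoeff f (lam k)) powr p) \<le> osc f"
proof -
  have "ennreal (\<Sum>k\<in>F. \<psi> k t * cmod (fcoeff f (lam k)) powr p)
      = (\<Sum>k\<in>F. ennreal (\<psi> k t * cmod (fcoeff f (lam k)) powr p))"
    using psi_nonneg by (intro sum_ennreal[symmetric]) auto
  also have "\<dots> \<le> (\<Sum>\<^sub>\<infinity>k\<in>UNIV. ennreal (\<psi> k t * cmod (fcoeff f (lam k)) powr p))"
    using assms by (intro sum_le_infsum_ennreal) auto
  also have "\<dots> \<le> osc f"
    unfolding osc_eq using assms by (intro SUP_upper)
  finally show ?thesis .
qed

text \<open>
  One of \<open>A\<^sub>1\<close>, \<open>A\<^sub>-\<^sub>1\<close> is nonzero, and \<open>\<phi>\<close> cannot vanish on the whole interval swept out by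
  \<open>\<lambda>\<^sub>1 h\<close>, as its zeros form a null set. This excludes \<open>C \<cdot> \<omega> = \<infinity> \<cdot> 0\<close>.
\<close>
lemma osc_pos:
  assumes "symmetric_series lam f"
  shows "osc f > 0"
proof -
  have "cmod (fcoeff f (lam 1)) + cmod (fcoeff f (lam (- 1))) > 0"
    using assms by (simp add: symmetric_series_def)
  then obtain k where k: "fcoeff f (lam k) \<noteq> 0" "k \<in> {1, -1}"
  proof (cases "fcoeff f (lam 1) = 0")
    case True
    with \<open>cmod _ + cmod _ > 0\<close> have "fcoeff f (lam (- 1)) \<noteq> 0" by auto
    then show ?thesis by (rule that) simp
  next
    case False
    then show ?thesis by (rule that) simp
  qed
  have "lam k \<noteq> 0" using k lam_pos[of 1] lam_minus[of 1] by auto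
  define c where "c = lam k / lam (int n)"
  have c: "c \<noteq> 0" using \<open>lam k \<noteq> 0\<close> lam_n by (simp add: c_def)
  have "\<exists>t\<in>{0..\<tau>}. \<phi> (lam k * t / lam (int n)) \<noteq> 0"
  proof (rule ccontr)
    assume "\<not> ?thesis"
    then have zero: "\<phi> (\<bar>c\<bar> * t) = 0" if "t \<in> {0..\<tau>}" for t
      using that phi_even[of "c * t"] by (auto simp: c_def abs_if)
    have "{0..\<bar>c\<bar> * \<tau>} \<subseteq> {t. \<phi> t = 0}"
    proof
      fix s assume "s \<in> {0..\<bar>c\<bar> * \<tau>}"
      then have "s / \<bar>c\<bar> \<in> {0..\<tau>}" using c by (auto simp: field_simps)
      from zero[OF this] c show "s \<in> {t. \<phi> t = 0}" by simp
    qed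
    moreover have "negligible {t. \<phi> t = 0}"
      using \<phi> by (simp add: Phi_def negligible_iff_null_sets)
    ultimately have "negligible (cbox 0 (\<bar>c\<bar> * \<tau>))"
      by (simp add: negligible_subset)
    moreover have "\<bar>c\<bar> * \<tau> > 0" using c \<tau> by simp
    ultimately show False by (simp only: negligible_interval) simp
  qed
  then obtain t where t: "t \<in> {0..\<tau>}" "\<phi> (lam k * t / lam (int n)) \<noteq> 0" by blast
  then have "\<psi> k t > 0" by (simp add: \<psi>_def)
  then have "0 < ennreal (\<Sum>k\<in>{k}. \<psi> k t * cmod (fcoeff f (lam k)) powr p)"
    using k by simp
  also have "\<dots> \<le> osc f" using t by (intro osc_ge) auto
  finally show ?thesis .
qed

lemma V_props:
  assumes "v \<in> V \<tau>"
  shows "mono_on {0..\<tau>} v" "v 0 < v \<tau>"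
proof -
  show m: "mono_on {0..\<tau>} v" using assms by (simp add: V_def)
  show "v 0 < v \<tau>"
  proof (rule ccontr)
    assume *: "\<not> v 0 < v \<tau>"
    have "v x = v 0" if "x \<in> {0..\<tau>}" for x
      using mono_onD[OF m, of 0 x] mono_onD[OF m, of x \<tau>] that * by fastforce
    then have "v constant_on {0..\<tau>}" unfolding constant_on_def by blast
    with assms show False by (simp add: V_def)
  qed
qed

lemma RS_psi_nonneg:
  assumes "mono_on {0..\<tau>} v"
  shows "0 \<le> RS_integral (\<psi> k) v 0 \<tau>"
  using RS_integral_mono[OF _ assms continuous_on_const psi_continuous, of 0 k] \<tau> psi_nonneg
  by (simp add: RS_integral_const assms)

lemma I_const_eq: "I_const p lam \<phi> n \<tau> v = (INF k\<in>{n..}. RS_integral (\<psi> (int k)) v 0 \<tau>)"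
  unfolding I_const_def \<psi>_def ..

lemma I_const_le:
  assumes "mono_on {0..\<tau>} v" "int n \<le> \<bar>k\<bar>"
  shows "I_const p lam \<phi> n \<tau> v \<le> RS_integral (\<psi> k) v 0 \<tau>"
proof -
  have "I_const p lam \<phi> n \<tau> v \<le> RS_integral (\<psi> (int (nat \<bar>k\<bar>))) v 0 \<tau>"
    unfolding I_const_eq using assms
    by (intro cINF_lower bdd_belowI2[of _ 0] RS_psi_nonneg) auto
  also have "\<psi> (int (nat \<bar>k\<bar>)) = \<psi> k" using psi_abs by auto
  finally show ?thesis .
qed

lemma I_const_ge: "(\<And>k. n \<le> k \<Longrightarrow> m \<le> RS_integral (\<psi> (int k)) v 0 \<tau>) \<Longrightarrow> m \<le> I_const p lam \<phi> n \<tau> v"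
  unfolding I_const_eq by (intro cINF_greatest) auto

text \<open>
  Looking at \<open>k = n\<close> alone gives \<open>I \<le> (v(\<tau>) - v(0)) max \<psi>\<^sub>n\<close>. Thus the infimum of the ratios is
  positive, and \<open>C \<cdot> \<omega>\<close> is infinite whenever \<open>\<omega>\<close> is.
\<close>
lemma ratio_lower_bound: "\<exists>c>0. \<forall>v\<in>V \<tau>. c \<le> ratio v"
proof -
  obtain B0 where B0: "\<And>t. t \<in> {0..\<tau>} \<Longrightarrow> \<psi> (int n) t \<le> B0"
    using psi_bounded by blast
  define B where "B = max 1 B0"
  have B: "B > 0" "\<And>t. t \<in> {0..\<tau>} \<Longrightarrow> \<psi> (int n) t \<le> B" using B0 by (auto simp: B_def intro: max.coboundedI2)
  have "ennreal (1 / B) \<le> ratio v" if v: "v \<in> V \<tau>" for v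
  proof -
    note vp = V_props[OF v]
    let ?I = "I_const p lam \<phi> n \<tau> v"
    have "?I \<le> RS_integral (\<psi> (int n)) v 0 \<tau>" using vp(1) by (rule I_const_le) simp
    also have "\<dots> \<le> RS_integral (\<lambda>_. B) v 0 \<tau>"
      using \<tau> vp B by (intro RS_integral_mono psi_continuous continuous_on_const) auto
    also have "\<dots> = B * (v \<tau> - v 0)" using \<tau> vp by (intro RS_integral_const) auto
    finally have I: "?I \<le> B * (v \<tau> - v 0)" .
    show ?thesis
    proof (cases "?I > 0")
      case True
      then have "1 / B \<le> (v \<tau> - v 0) / ?I" using I B by (simp add: field_simps)
      then show ?thesis unfolding V_quotient_def using True vp by (simp add: divide_ennreal)
    next
      case False
      then have I0: "ennreal ?I = 0" by (simp add: ennreal_eq_0_iff)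
      show ?thesis unfolding V_quotient_def I0 using vp by (simp add: ennreal_eq_0_iff)
    qed
  qed
  with B(1) show ?thesis by (intro exI[of _ "ennreal (1 / B)"]) auto
qed

text \<open>
  Weak duality. Working with finite partial sums of the tail avoids exchanging the Stieltjes integral
  with an infinite sum.
\<close>
lemma tail_le_ratio:
  assumes f: "symmetric_series lam f" and v: "v \<in> V \<tau>"
  shows "tail f \<le> osc f * ratio v"
proof -
  note vp = V_props[OF v]
  let ?I = "I_const p lam \<phi> n \<tau> v"
  let ?a = "\<lambda>k. cmod (fcoeff f (lam k)) powr p"
  have Q: "ratio v > 0"
    using ratio_lower_bound v by (metis order_less_le_trans)
  consider "osc f = top" | "\<not> ?I > 0" | w where "osc f = ennreal w" "w \<ge> 0" "?I > 0"
    by (cases "osc f") auto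
  then show ?thesis
  proof cases
    case 1
    with Q show ?thesis by (simp add: ennreal_top_mult)
  next
    case 2
    then have I0: "ennreal ?I = 0" by (simp add: ennreal_eq_0_iff)
    have "ratio v = top" unfolding V_quotient_def I0 using vp by (simp add: ennreal_eq_0_iff)
    with osc_pos[OF f] show ?thesis by (simp add: ennreal_mult_top)
  next
    case (3 w)
    have "tail f \<le> ennreal (w * ((v \<tau> - v 0) / ?I))"
      unfolding tail_sum_def
    proof (rule infsum_le_ennreal)
      fix F assume F: "finite F" "F \<subseteq> {k. int n \<le> \<bar>k\<bar>}"
      have "(\<Sum>k\<in>F. ?a k) * ?I \<le> (\<Sum>k\<in>F. ?a k * RS_integral (\<psi> k) v 0 \<tau>)"
        unfolding sum_distrib_right using F vp
        by (intro sum_mono mult_left_mono I_const_le) auto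
      also have "\<dots> = RS_integral (\<lambda>t. \<Sum>k\<in>F. ?a k * \<psi> k t) v 0 \<tau>"
        using \<tau> vp by (intro RS_integral_sum[symmetric] psi_continuous) auto
      also have "\<dots> \<le> RS_integral (\<lambda>_. w) v 0 \<tau>"
      proof (intro RS_integral_mono)
        fix t assume "t \<in> {0..\<tau>}"
        from osc_ge[OF this F(1), of f] show "(\<Sum>k\<in>F. ?a k * \<psi> k t) \<le> w"
          using 3 by (simp add: mult.commute)
      qed (use \<tau> vp in \<open>auto intro!: continuous_intros psi_continuous\<close>)
      also have "\<dots> = w * (v \<tau> - v 0)" using \<tau> vp by (intro RS_integral_const) auto
      finally have "(\<Sum>k\<in>F. ?a k) \<le> w * ((v \<tau> - v 0) / ?I)"
        using 3 by (simp add: field_simps)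
      then show "(\<Sum>k\<in>F. ennreal (?a k)) \<le> ennreal (w * ((v \<tau> - v 0) / ?I))"
        by (subst sum_ennreal) (auto intro: ennreal_leI)
    qed
    also have "\<dots> = osc f * ratio v"
      unfolding V_quotient_def using 3 vp by (subst ennreal_mult') (auto simp: divide_ennreal)
    finally show ?thesis .
  qed
qed

lemma tail_le_INF:
  assumes f: "symmetric_series lam f"
  shows "tail f \<le> (INF v\<in>V \<tau>. ratio v) * osc f"
proof (cases "osc f = top")
  case True
  obtain c where "c > 0" "\<And>v. v \<in> V \<tau> \<Longrightarrow> c \<le> ratio v"
    using ratio_lower_bound by blast
  then have "(INF v\<in>V \<tau>. ratio v) > 0"
    by (meson INF_greatest order_less_le_trans)
  with True show ?thesis by (simp add: ennreal_mult_top)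
next
  case False
  have "tail f / osc f \<le> (INF v\<in>V \<tau>. ratio v)"
    using tail_le_ratio[OF f] osc_pos[OF f] by (intro INF_greatest divide_le_posI_ennreal)
  then have "tail f / osc f * osc f \<le> (INF v\<in>V \<tau>. ratio v) * osc f"
    by (rule mult_right_mono) simp
  moreover have "tail f / osc f * osc f = tail f"
    using False osc_pos[OF f] by (simp add: ennreal_divide_times top.not_eq_extremum)
  ultimately show ?thesis by simp
qed

section \<open>Strong duality\<close>

text \<open>
  Any positive sequence with summable \<open>p\<close>-th roots occurs as \<open>|A\<^sub>k|\<^sup>p\<close>, \<open>k \<ge> 1\<close>. One-sided series
  suffice, since the symmetric form only asks for \<open>|A\<^sub>k| + |A\<^sub>-\<^sub>k| > 0\<close>.
  The sequence is indexed from 0, with \<open>\<beta> k\<close> belonging to \<open>\<lambda>\<^sub>k\<^sub>+\<^sub>1\<close>.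
\<close>
lemma test_function:
  assumes \<beta>: "\<And>k. \<beta> k > 0" "summable \<beta>" "summable (\<lambda>k. \<beta> k powr (1 / p))"
  obtains f where "f \<in> BS_sym p lam"
    "\<And>k. cmod (fcoeff f (lam (int (Suc k)))) powr p = \<beta> k"
    "\<And>k. k \<le> 0 \<Longrightarrow> fcoeff f (lam k) = 0"
proof -
  define a where "a k = complex_of_real (\<beta> k powr (1 / p))" for k
  define \<mu> where "\<mu> k = lam (int (Suc k))" for k
  define f where "f = (\<lambda>x. \<Sum>k. a k * cis (\<mu> k * x))"
  have a: "summable (\<lambda>k. cmod (a k))"
    using \<beta>(3) by (simp add: a_def)
  have \<mu>: "inj \<mu>"
    unfolding \<mu>_def by (intro injI) (auto dest!: injD[OF lam_inj])
  have coeff: "fcoeff f (\<mu> k) = a k" for k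
    unfolding f_def using a \<mu> by (rule fcoeff_series_exponent)
  have coeff0: "fcoeff f l = 0" if "l \<notin> range \<mu>" for l
    unfolding f_def using a \<mu> that by (rule fcoeff_series_other)
  have abs: "cmod (fcoeff f (\<mu> k)) powr p = \<beta> k" for k
    using \<beta>(1)[of k] p by (simp add: coeff a_def powr_powr)
  have pos: "\<exists>j. lam k = \<mu> j" if "k > 0" for k
    using that by (intro exI[of _ "nat (k - 1)"]) (simp add: \<mu>_def)
  show ?thesis
  proof (rule that)
    show "cmod (fcoeff f (lam (int (Suc k)))) powr p = \<beta> k" for k
      using abs[of k] by (simp add: \<mu>_def)
    show "fcoeff f (lam k) = 0" if "k \<le> 0" for k
      using that by (intro coeff0) (auto simp: \<mu>_def dest!: injD[OF lam_inj])
    have "symmetric_series lam f"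
      unfolding symmetric_series_def
    proof (intro conjI allI impI)
      show "fourier_exponents f \<subseteq> range lam"
        using coeff0 unfolding fourier_exponents_def \<mu>_def by blast
      fix k :: int assume "k > 0"
      from pos[OF this] obtain j where "lam k = \<mu> j" ..
      then have "fcoeff f (lam k) \<noteq> 0" using \<beta>(1)[of j] by (simp add: coeff a_def)
      then show "0 < cmod (fcoeff f (lam k)) + cmod (fcoeff f (lam (- k)))"
        by (intro add_pos_nonneg) auto
    qed
    moreover have "(\<Sum>\<^sub>\<infinity>l\<in>fourier_exponents f. ennreal (cmod (fcoeff f l) powr p)) \<le> ennreal (suminf \<beta>)"
    proof (rule infsum_le_ennreal)
      fix F assume F: "finite F" "F \<subseteq> fourier_exponents f"
      then have "F \<subseteq> range \<mu>" using coeff0 by (auto simp: fourier_exponents_def)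
      then obtain J where J: "finite J" "F = \<mu> ` J"
        using finite_subset_image[OF F(1)] by blast
      have "(\<Sum>l\<in>F. ennreal (cmod (fcoeff f l) powr p)) = (\<Sum>k\<in>J. ennreal (\<beta> k))"
        unfolding J(2) using \<mu> by (subst sum.reindex) (auto simp: abs intro: inj_on_subset)
      also have "\<dots> = ennreal (\<Sum>k\<in>J. \<beta> k)"
        using \<beta>(1) by (intro sum_ennreal) (auto intro: less_imp_le)
      also have "\<dots> \<le> ennreal (suminf \<beta>)"
        using \<beta> J by (intro ennreal_leI sum_le_suminf) (auto intro: less_imp_le)
      finally show "(\<Sum>l\<in>F. ennreal (cmod (fcoeff f l) powr p)) \<le> ennreal (suminf \<beta>)" .
    qed
    then have "bs_norm p f < \<infinity>"
      unfolding bs_norm_def epowr_def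
      by (auto simp: top_unique)
    moreover have "Bap f" unfolding f_def using a by (rule Bap_series)
    ultimately show "f \<in> BS_sym p lam" by (simp add: BS_sym_def BS_def)
  qed
qed

lemma osc_le:
  assumes abs: "\<And>k. cmod (fcoeff f (lam (int (Suc k)))) powr p = \<beta> k"
    and zero: "\<And>k. k \<le> 0 \<Longrightarrow> fcoeff f (lam k) = 0"
    and le: "\<And>t J. t \<in> {0..\<tau>} \<Longrightarrow> finite J \<Longrightarrow> (\<Sum>k\<in>J. \<psi> (int (Suc k)) t * \<beta> k) \<le> c"
  shows "osc f \<le> ennreal c"
  unfolding osc_eq
proof (intro SUP_least infsum_le_ennreal)
  fix t F assume t: "t \<in> {0..\<tau>}" and F: "finite (F :: int set)" "F \<subseteq> UNIV"
  have sub: "F \<inter> {0<..} \<subseteq> range (\<lambda>k. int (Suc k))"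
  proof
    fix k assume "k \<in> F \<inter> {0<..}"
    then have "k = int (Suc (nat (k - 1)))" by auto
    then show "k \<in> range (\<lambda>k. int (Suc k))" by blast
  qed
  obtain J where J: "finite J" "F \<inter> {0<..} = (\<lambda>k. int (Suc k)) ` J"
    using finite_subset_image[OF finite_subset[OF Int_lower1 F(1)] sub] by blast
  have "(\<Sum>k\<in>F. ennreal (\<psi> k t * cmod (fcoeff f (lam k)) powr p))
      = (\<Sum>k\<in>F \<inter> {0<..}. ennreal (\<psi> k t * cmod (fcoeff f (lam k)) powr p))"
    using F zero by (intro sum.mono_neutral_right) (auto simp: not_less)
  also have "\<dots> = (\<Sum>k\<in>J. ennreal (\<psi> (int (Suc k)) t * \<beta> k))"
    unfolding J(2) by (subst sum.reindex) (auto simp: inj_on_def abs[simplified])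
  also have "\<dots> = ennreal (\<Sum>k\<in>J. \<psi> (int (Suc k)) t * \<beta> k)"
    using psi_nonneg abs by (intro sum_ennreal) (metis mult_nonneg_nonneg powr_ge_zero)
  also have "\<dots> \<le> ennreal c" using le[OF t J(1)] by (rule ennreal_leI)
  finally show "(\<Sum>k\<in>F. ennreal (\<psi> k t * cmod (fcoeff f (lam k)) powr p)) \<le> ennreal c" .
qed

lemma tail_ge:
  assumes abs: "\<And>k. cmod (fcoeff f (lam (int (Suc k)))) powr p = \<beta> k"
    and b: "summable b" "\<And>i. b i \<le> \<beta> (n - 1 + i)"
  shows "ennreal (suminf b) \<le> tail f"
proof (cases "tail f")
  case (real r)
  have "sum b {..<m} \<le> r" for m
  proof -
    have "ennreal (sum b {..<m}) \<le> ennreal (\<Sum>i<m. \<beta> (n - 1 + i))"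
      using b by (intro ennreal_leI sum_mono)
    also have "\<dots> = (\<Sum>i<m. ennreal (\<beta> (n - 1 + i)))"
      using abs by (intro sum_ennreal[symmetric]) (metis powr_ge_zero)
    also have "\<dots> = (\<Sum>k\<in>(\<lambda>i. int (n + i)) ` {..<m}. ennreal (cmod (fcoeff f (lam k)) powr p))"
    proof (subst sum.reindex)
      have "\<beta> (n - 1 + i) = cmod (fcoeff f (lam (int (n + i)))) powr p" for i
        using abs[of "n - 1 + i"] n by simp
      then show "(\<Sum>i<m. ennreal (\<beta> (n - 1 + i)))
          = (\<Sum>i<m. ((\<lambda>k. ennreal (cmod (fcoeff f (lam k)) powr p)) \<circ> (\<lambda>i. int (n + i))) i)"
        by simp
    qed (auto simp: inj_on_def)
    also have "\<dots> \<le> tail f"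
      unfolding tail_sum_def by (intro sum_le_infsum_ennreal) auto
    finally show ?thesis using real by simp
  qed
  then have "suminf b \<le> r" using b(1) by (intro suminf_le_const) auto
  with real show ?thesis by (simp add: ennreal_leI)
qed simp

text \<open>
  Since \<open>\<phi>\<close> may be unbounded, upper bounds \<open>M\<^sub>k\<close> of \<open>\<psi>\<^sub>k\<^sub>+\<^sub>1\<close> on \<open>[0, \<tau>]\<close> may have to grow
  arbitrarily fast. The weights decay so quickly that first and second moments of \<open>M\<close> converge (for the
  minimax lemma and the oscillation) and that \<open>p\<close>-th roots are summable (for \<open>test_function\<close>).
\<close>
lemma weights_exist:
  obtains w M where "\<And>k. w k > 0" "summable w" "summable (\<lambda>k. w k * M k)"
    "summable (\<lambda>k. w k * (M k)\<^sup>2)" "summable (\<lambda>k. w k powr (1 / p))"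
    "\<And>k t. t \<in> {0..\<tau>} \<Longrightarrow> \<psi> (int (Suc k)) t \<le> M k" "\<And>k. 0 \<le> M k"
proof -
  have "\<exists>M. \<forall>k. \<forall>t\<in>{0..\<tau>}. \<psi> (int (Suc k)) t \<le> M k"
    using psi_bounded by (intro choice allI)
  then obtain M where M: "\<And>k t. t \<in> {0..\<tau>} \<Longrightarrow> \<psi> (int (Suc k)) t \<le> M k" by blast
  have M0: "0 \<le> M k" for k
    using M[of 0 k] \<tau> by (simp add: psi_zero)
  define w where "w k = ((1/2) ^ k) powr p / (1 + M k)\<^sup>2" for k :: nat
  have pow: "((1/2) ^ k) powr p \<le> (1/2 :: real) ^ k" for k
    using powr_mono'[of 1 p "(1/2) ^ k"] p by (simp add: power_le_one)
  have geom: "summable (\<lambda>k. (1/2 :: real) ^ k)" by simp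
  have bound: "w k * c \<le> (1/2) ^ k" if "0 \<le> c" "c \<le> (1 + M k)\<^sup>2" for k c
  proof -
    have "w k * c = ((1/2) ^ k) powr p * (c / (1 + M k)\<^sup>2)" by (simp add: w_def)
    also have "\<dots> \<le> (1/2) ^ k * 1"
      using pow that M0[of k] by (intro mult_mono) (auto simp: divide_le_eq_1)
    finally show ?thesis by simp
  qed
  have wpos: "w k > 0" for k
    using M0[of k] by (auto simp: w_def intro!: divide_pos_pos zero_less_power)
  have summ: "summable (\<lambda>k. w k * c k)" if "\<And>k. 0 \<le> c k" "\<And>k. c k \<le> (1 + M k)\<^sup>2" for c
    using that bound wpos by (intro summable_comparison_test'[OF geom, of 0]) (auto simp: abs_mult less_imp_le)
  show ?thesis
  proof (rule that[of w M])
    show "w k > 0" for k by (rule wpos)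
    show "summable w"
      using summ[of "\<lambda>_. 1"] M0 by (simp add: one_le_power)
    show "summable (\<lambda>k. w k * M k)"
    proof (rule summ)
      show "M k \<le> (1 + M k)\<^sup>2" for k using M0[of k] by (simp add: power2_eq_square algebra_simps)
    qed (rule M0)
    show "summable (\<lambda>k. w k * (M k)\<^sup>2)"
      using M0 by (intro summ) (auto intro!: power_mono)
    show "summable (\<lambda>k. w k powr (1 / p))"
    proof (rule summable_comparison_test'[OF geom, of 0])
      fix k
      have "w k \<le> ((1/2) ^ k) powr p"
        unfolding w_def using M0[of k] by (simp add: divide_le_eq one_le_power mult_le_cancel_left1)
      then have "w k powr (1 / p) \<le> (((1/2) ^ k) powr p) powr (1 / p)"
        using wpos[of k] p by (intro powr_mono2) auto
      also have "\<dots> = (1/2) ^ k" using p by (simp add: powr_powr)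
      finally show "norm (w k powr (1 / p)) \<le> (1/2) ^ k" by simp
    qed
  qed (use M M0 in auto)
qed

text \<open>
  Strong duality and the existence of an optimal \<open>v\<close>, in the case that the supremum \<open>\<kappa> = K\<^sup>p\<close> is finite.
\<close>
lemma ratio_le_SUP:
  assumes fin: "(SUP f\<in>BS_sym p lam. tail f / osc f) < top"
  shows "\<exists>v\<in>V \<tau>. ratio v \<le> (SUP f\<in>BS_sym p lam. tail f / osc f)"
proof -
  obtain \<kappa> where \<kappa>: "(SUP f\<in>BS_sym p lam. tail f / osc f) = ennreal \<kappa>" "\<kappa> \<ge> 0"
    using fin by (cases "SUP f\<in>BS_sym p lam. tail f / osc f") auto
  obtain w M where w: "\<And>k. w k > 0" "summable w" "summable (\<lambda>k. w k * M k)"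
    "summable (\<lambda>k. w k * (M k)\<^sup>2)" "summable (\<lambda>k. w k powr (1 / p))"
    and M: "\<And>k t. t \<in> {0..\<tau>} \<Longrightarrow> \<psi> (int (Suc k)) t \<le> M k" "\<And>k. 0 \<le> M k"
    using weights_exist by blast
  define W where "W = (\<Sum>k. w k * M k)"
  have W: "W \<ge> 0" unfolding W_def using w M by (intro suminf_nonneg) (auto simp: less_imp_le)
  define n0 where "n0 = n - 1"
  have n0: "Suc (n0 + i) = n + i" for i using n by (simp add: n0_def)
  define w' where "w' i = w (n0 + i)" for i
  define M' where "M' i = M (n0 + i)" for i
  have shift: "summable (\<lambda>i. g (n0 + i))" if "summable g" for g :: "nat \<Rightarrow> real"
    using summable_ignore_initial_segment[OF that, of n0] by (simp add: add.commute)
  have M': "\<psi> (int (n + i)) t \<le> M' i" if "t \<in> {0..\<tau>}" for t i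
    using M(1)[OF that, of "n0 + i"] unfolding n0 M'_def .

  have summable_b: "summable b" if b: "\<And>i. 0 \<le> b i" "\<And>i. b i \<le> C * w' i" and C: "C \<ge> 0" for b C
    using b unfolding w'_def
    by (intro summable_comparison_test'[OF summable_mult[OF shift[OF w(2)], of C], of 0]) auto
  have summable_b_psi: "summable (\<lambda>i. b i * \<psi> (int (n + i)) t)"
    if b: "\<And>i. 0 \<le> b i" "\<And>i. b i \<le> C * w' i" and C: "C \<ge> 0" and t: "t \<in> {0..\<tau>}" for b C t
  proof (rule summable_comparison_test'[OF summable_mult[OF shift[OF w(3)], of C], of 0])
    fix i
    have "b i * \<psi> (int (n + i)) t \<le> (C * w' i) * M' i"
      using b[of i] M'[OF t, of i] psi_nonneg w(1) C
      by (intro mult_mono) (auto simp: w'_def less_imp_le)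
    then show "norm (b i * \<psi> (int (n + i)) t) \<le> C * (w (n0 + i) * M (n0 + i))"
      using b(1)[of i] psi_nonneg[of "int (n + i)" t] by (simp add: w'_def M'_def mult.assoc abs_mult)
  qed

  \<comment> \<open>Sharpness of \<open>\<kappa>\<close>, read off from functions whose coefficients are \<open>b\<close>. The class requires
    \<open>|A\<^sub>k| + |A\<^sub>-\<^sub>k| > 0\<close> for every \<open>k \<ge> 1\<close>, so \<open>b\<close> is perturbed by \<open>\<eta> w\<close>, which raises the oscillation by at
    most \<open>\<eta> W\<close>.\<close>
  have test: "suminf b \<le> \<kappa> * (c + \<eta> * W)"
    if b: "\<And>i. 0 \<le> b i" "\<And>i. b i \<le> C * w' i"
      and \<eta>: "\<eta> > 0" and C: "C \<ge> 0"
      and c: "\<And>t. t \<in> {0..\<tau>} \<Longrightarrow> (\<Sum>i. b i * \<psi> (int (n + i)) t) \<le> c" for b C \<eta> c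
  proof -
    define \<beta> where "\<beta> k = (if k < n0 then 0 else b (k - n0)) + \<eta> * w k" for k
    have \<beta>0: "0 \<le> (if k < n0 then 0 else b (k - n0))" for k using b(1) by simp
    have \<beta>1: "\<beta> k > 0" for k
      unfolding \<beta>_def using \<beta>0[of k] w(1)[of k] \<eta> by (intro add_nonneg_pos) auto
    have \<beta>2: "\<beta> k \<le> (C + \<eta>) * w k" for k
      unfolding \<beta>_def using b(2)[of "k - n0"] C w(1)[of k] by (auto simp: w'_def algebra_simps)
    have "summable \<beta>"
      using \<beta>1 \<beta>2 by (intro summable_comparison_test'[OF summable_mult[OF w(2), of "C + \<eta>"], of 0]) (simp add: less_imp_le)
    moreover have "summable (\<lambda>k. \<beta> k powr (1 / p))"
    proof (rule summable_comparison_test'[OF summable_mult[OF w(5), of "(C + \<eta>) powr (1 / p)"], of 0])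
      fix k
      have "\<beta> k powr (1 / p) \<le> ((C + \<eta>) * w k) powr (1 / p)"
        using \<beta>1[of k] \<beta>2[of k] p by (intro powr_mono2) auto
      also have "\<dots> = (C + \<eta>) powr (1 / p) * w k powr (1 / p)"
        by (rule powr_mult)
      finally show "norm (\<beta> k powr (1 / p)) \<le> (C + \<eta>) powr (1 / p) * w k powr (1 / p)" by simp
    qed
    ultimately obtain f where f: "f \<in> BS_sym p lam"
      and abs: "\<And>k. cmod (fcoeff f (lam (int (Suc k)))) powr p = \<beta> k"
      and zero: "\<And>k. k \<le> 0 \<Longrightarrow> fcoeff f (lam k) = 0"
      using \<beta>1 test_function by metis
    note sb = summable_b[OF b(1) b(2) C] and sbp = summable_b_psi[OF b(1) b(2) C]
    have osc_bound: "osc f \<le> ennreal (c + \<eta> * W)"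
    proof (rule osc_le[OF abs zero])
      fix t J assume t: "t \<in> {0..\<tau>}" and J: "finite (J :: nat set)"
      have "(\<Sum>k\<in>J. \<psi> (int (Suc k)) t * \<beta> k)
          = (\<Sum>k\<in>J. \<psi> (int (Suc k)) t * (if k < n0 then 0 else b (k - n0))) + \<eta> * (\<Sum>k\<in>J. w k * \<psi> (int (Suc k)) t)"
        unfolding \<beta>_def by (simp add: algebra_simps sum.distrib sum_distrib_left)
      also have "(\<Sum>k\<in>J. \<psi> (int (Suc k)) t * (if k < n0 then 0 else b (k - n0)))
          = (\<Sum>k\<in>J \<inter> {n0..}. b (k - n0) * \<psi> (int (n + (k - n0))) t)"
      proof (rule sum.mono_neutral_cong_right)
        show "\<psi> (int (Suc k)) t * (if k < n0 then 0 else b (k - n0)) = b (k - n0) * \<psi> (int (n + (k - n0))) t"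
          if "k \<in> J \<inter> {n0..}" for k
          using that n0[of "k - n0"] by auto
      qed (use J in auto)
      also have "\<dots> = (\<Sum>i\<in>(\<lambda>k. k - n0) ` (J \<inter> {n0..}). b i * \<psi> (int (n + i)) t)"
        by (subst sum.reindex) (auto simp: inj_on_def add_diff_eq)
      also have "\<dots> \<le> (\<Sum>i. b i * \<psi> (int (n + i)) t)"
        using J b psi_nonneg by (intro sum_le_suminf sbp t) auto
      also have "\<dots> \<le> c" using c[OF t] .
      also have "(\<Sum>k\<in>J. w k * \<psi> (int (Suc k)) t) \<le> (\<Sum>k\<in>J. w k * M k)"
        using w(1) M(1)[OF t] by (intro sum_mono mult_left_mono) (auto simp: less_imp_le)
      also have "\<dots> \<le> W"
        unfolding W_def using J w M(2) by (intro sum_le_suminf) (auto simp: less_imp_le)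
      finally show "(\<Sum>k\<in>J. \<psi> (int (Suc k)) t * \<beta> k) \<le> c + \<eta> * W"
        using \<eta> by simp
    qed
    have pos: "osc f > 0" using f by (intro osc_pos) (simp add: BS_sym_def)
    have ntop: "osc f < top" using osc_bound by (rule le_less_trans) simp
    have "0 < ennreal (c + \<eta> * W)" using pos osc_bound by (rule less_le_trans)
    then have cW: "c + \<eta> * W > 0" by simp
    have "ennreal (suminf b) \<le> tail f"
    proof (rule tail_ge[OF abs sb])
      show "b i \<le> \<beta> (n - 1 + i)" for i
      proof -
        have "0 \<le> \<eta> * w (n0 + i)" using w(1)[of "n0 + i"] \<eta> by simp
        then show ?thesis unfolding n0_def[symmetric] \<beta>_def by simp
      qed
    qed
    also have "tail f = tail f / osc f * osc f"
      using pos ntop by (simp add: ennreal_divide_times)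
    also have "\<dots> \<le> ennreal \<kappa> * ennreal (c + \<eta> * W)"
      unfolding \<kappa>(1)[symmetric] using f by (intro mult_mono SUP_upper osc_bound) auto
    also have "\<dots> = ennreal (\<kappa> * (c + \<eta> * W))"
      using \<kappa>(2) by (rule ennreal_mult'[symmetric])
    finally show ?thesis
      using \<kappa>(2) cW by (subst (asm) ennreal_le_iff) auto
  qed

  have "\<kappa> > 0"
  proof (rule ccontr)
    assume "\<not> \<kappa> > 0"
    with \<kappa>(2) have "\<kappa> = 0" by simp
    have "suminf w' \<le> \<kappa> * ((\<Sum>i. w' i * M' i) + 1 * W)"
    proof (rule test[where C = 1])
      fix t assume t: "t \<in> {0..\<tau>}"
      have sum: "summable (\<lambda>i. w' i * M' i)" unfolding w'_def M'_def using w(3) by (rule shift)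
      have le: "w' i * \<psi> (int (n + i)) t \<le> w' i * M' i" for i
        using M'[OF t, of i] w(1) by (intro mult_left_mono) (auto simp: w'_def less_imp_le)
      have "summable (\<lambda>i. w' i * \<psi> (int (n + i)) t)"
        using le psi_nonneg w(1)
        by (intro summable_comparison_test'[OF sum, of 0]) (auto simp: w'_def less_imp_le abs_mult)
      then show "(\<Sum>i. w' i * \<psi> (int (n + i)) t) \<le> (\<Sum>i. w' i * M' i)"
        using le sum by (intro suminf_le) auto
    qed (use w(1) in \<open>auto simp: w'_def less_imp_le\<close>)
    moreover have "suminf w' > 0"
      unfolding w'_def using w(1) by (intro suminf_pos shift w(2)) auto
    ultimately show False using \<open>\<kappa> = 0\<close> by simp
  qed
  \<comment> \<open>The integrals \<open>\<integral> \<psi>\<^sub>k dv\<close> should all reach the level \<open>m\<close>.\<close>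
  define m where "m = 1 / \<kappa>"
  have m: "m > 0" "\<kappa> * m = 1" using \<open>\<kappa> > 0\<close> by (auto simp: m_def)

  define moments where "moments v = (\<lambda>i. RS_integral (\<psi> (int (n + i))) v 0 \<tau>)" for v
  have atom: "(\<lambda>i. \<psi> (int (n + i)) t) \<in> moments ` distribution_functions \<tau>" if "0 < t" "t \<le> \<tau>" for t
  proof
    show "(\<lambda>i. \<psi> (int (n + i)) t) = moments (indicator {t..})"
      unfolding moments_def using that by (subst RS_integral_step) (auto intro: psi_continuous)
    show "indicator {t..} \<in> distribution_functions \<tau>"
      using that by (auto simp: distribution_functions_def mono_def indicator_def)
  qed
  have "\<exists>x\<in>moments ` distribution_functions \<tau>. \<forall>i. m \<le> x i"
  proof (rule minimax_sequences[where M = M' and w = w'])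
    show "compact (moments ` distribution_functions \<tau>)"
      unfolding moments_def using \<tau>
      by (intro compact_continuous_image compact_distribution_functions continuous_on_coordinatewise_then_product
          continuous_on_RS_integral psi_continuous)
    show "moments ` distribution_functions \<tau> \<noteq> {}" using atom[of \<tau>] \<tau> by auto
    show "0 \<le> x i \<and> x i \<le> M' i" if x: "x \<in> moments ` distribution_functions \<tau>" for x i
    proof -
      obtain v where v: "v \<in> distribution_functions \<tau>" "x = moments v" using x by blast
      note mv = mono_on_distribution_function[OF v(1), of "{0..\<tau>}"]
      have "x i \<le> RS_integral (\<lambda>_. M' i) v 0 \<tau>"
        unfolding v(2) moments_def using \<tau> mv M'
        by (intro RS_integral_mono psi_continuous continuous_on_const) auto
      also have "\<dots> = M' i"
        using \<tau> mv v(1) by (subst RS_integral_const) (auto simp: distribution_functions_def)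
      finally show ?thesis using RS_psi_nonneg[OF mv] by (simp add: v(2) moments_def)
    qed
    show "(\<lambda>k. (1 - s) * x k + s * y k) \<in> moments ` distribution_functions \<tau>"
      if xy: "x \<in> moments ` distribution_functions \<tau>" "y \<in> moments ` distribution_functions \<tau>" and s: "0 \<le> s" "s \<le> 1" for x y s
    proof -
      obtain v u where vu: "v \<in> distribution_functions \<tau>" "x = moments v" "u \<in> distribution_functions \<tau>" "y = moments u"
        using xy by blast
      show ?thesis
      proof
        show "(\<lambda>k. (1 - s) * x k + s * y k) = moments (\<lambda>z. (1 - s) * v z + s * u z)"
          unfolding vu moments_def using \<tau> vu
          by (subst RS_integral_integrator_linear) (auto intro: mono_on_distribution_function psi_continuous)
        show "(\<lambda>z. (1 - s) * v z + s * u z) \<in> distribution_functions \<tau>"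
          using vu(1,3) s by (auto simp: distribution_functions_def mono_def intro!: add_mono mult_left_mono)
      qed
    qed
    show "w' k > 0" for k using w(1) by (simp add: w'_def)
    show "summable w'" unfolding w'_def using w(2) by (rule shift)
    show "summable (\<lambda>k. w' k * (M' k)\<^sup>2)" unfolding w'_def M'_def using w(4) by (rule shift)
    show "m \<ge> 0" using m by simp
    fix b and e :: real assume b: "\<And>k. 0 \<le> b k \<and> b k \<le> m * w' k" and e: "e > 0"
    show "\<exists>y\<in>moments ` distribution_functions \<tau>. m * suminf b - e \<le> (\<Sum>k. b k * y k)"
    proof (rule ccontr)
      assume "\<not> ?thesis"
      then have less: "(\<Sum>k. b k * \<psi> (int (n + k)) t) < m * suminf b - e" if "0 < t" "t \<le> \<tau>" for t
        using bspec[OF _ atom[OF that]] by (auto simp: not_le)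
      define \<eta> where "\<eta> = e / (2 * (W + 1))"
      have \<eta>: "\<eta> > 0" "\<eta> * W \<le> e / 2"
        using e W by (auto simp: \<eta>_def field_simps)
      have "suminf b \<le> \<kappa> * ((m * suminf b - e) + \<eta> * W)"
      proof (rule test[where C = m])
        fix t assume t: "t \<in> {0..\<tau>}"
        show "(\<Sum>i. b i * \<psi> (int (n + i)) t) \<le> m * suminf b - e"
        \<comment> \<open>There is no jump at 0 available, but there the integrands vanish.\<close>
        proof (cases "t = 0")
          case True
          have "0 \<le> (\<Sum>i. b i * \<psi> (int (n + i)) \<tau>)"
            using b psi_nonneg m \<tau> by (intro suminf_nonneg summable_b_psi[where C = m]) auto
          with less[of \<tau>] \<tau> True show ?thesis by (simp add: psi_zero)
        next
          case False
          with less[of t] t show ?thesis by simp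
        qed
      qed (use b m \<eta> in auto)
      also have "\<dots> \<le> \<kappa> * (m * suminf b - e / 2)"
        using \<eta> \<kappa> by (intro mult_left_mono) auto
      also have "\<dots> = suminf b - \<kappa> * e / 2"
        using m(2) by (simp add: right_diff_distrib mult.assoc[symmetric])
      finally show False using mult_pos_pos[OF \<open>\<kappa> > 0\<close> e] by simp
    qed
  qed
  then obtain v where v: "v \<in> distribution_functions \<tau>" and moments: "\<And>i. m \<le> moments v i" by blast
  have v01: "v 0 = 0" "v \<tau> = 1" using v by (auto simp: distribution_functions_def)
  have mono: "mono_on {0..\<tau>} v" using v by (rule mono_on_distribution_function)
  have "v \<in> V \<tau>"
  proof -
    have "v x \<in> {0..1}" if "x \<in> {0..\<tau>}" for x
      using that mono_onD[OF mono, of 0 x] mono_onD[OF mono, of x \<tau>] v01 by auto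
    then have "bounded (v ` {0..\<tau>})"
      by (auto intro!: boundedI[of _ 1])
    moreover have "\<not> v constant_on {0..\<tau>}"
      using v01 \<tau> by (fastforce simp: constant_on_def)
    ultimately show ?thesis using mono by (simp add: V_def)
  qed
  moreover have "ratio v \<le> ennreal \<kappa>"
  proof -
    have I: "m \<le> I_const p lam \<phi> n \<tau> v"
    proof (rule I_const_ge)
      fix k assume "n \<le> k"
      with moments[of "k - n"] show "m \<le> RS_integral (\<psi> (int k)) v 0 \<tau>"
        by (simp add: moments_def)
    qed
    with m have "0 < I_const p lam \<phi> n \<tau> v" by linarith
    with I have "1 / I_const p lam \<phi> n \<tau> v \<le> \<kappa>"
      using m \<open>\<kappa> > 0\<close> by (simp add: m_def field_simps)
    with I m show ?thesis
      unfolding V_quotient_def v01 by (simp add: divide_ennreal ennreal_leI flip: ennreal_1)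
  qed
  ultimately show ?thesis unfolding \<kappa>(1) by blast
qed

end

section \<open>The sharp constant\<close>

theorem theorem1:
  fixes p \<tau> :: real and lam :: "int \<Rightarrow> real" and n :: nat and \<phi> :: "real \<Rightarrow> real"
  assumes "1 \<le> p" and "admissible lam" and "\<tau> > 0" and "n \<ge> 1" and "\<phi> \<in> Phi"
  shows "(\<forall>f\<in>BS_sym p lam.
            best_approx p (lam (int n)) f
              \<le> C_const p lam \<phi> n \<tau> * modulus p lam \<phi> f (\<tau> / lam (int n)))
       \<and> (\<exists>v\<in>V \<tau>. V_quotient p lam \<phi> n \<tau> v = (INF u\<in>V \<tau>. V_quotient p lam \<phi> n \<tau> u))
       \<and> C_const p lam \<phi> n \<tau> = K_const p lam \<phi> n \<tau>"
proof -
  interpret smoothness_setting p \<tau> lam n \<phi>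
    using assms by unfold_locales
  let ?C = "INF v\<in>V \<tau>. ratio v" and ?K = "SUP f\<in>BS_sym p lam. tail f / osc f"
  have p0: "p > 0" "1 / p > 0" using p by auto
  have best: "best_approx p (lam (int n)) f = epowr (tail f) (1 / p)" if "f \<in> BS_sym p lam" for f
    using that p lam n by (intro best_approx_eq) (auto simp: BS_sym_def BS_def symmetric_series_def)
  have modulus: "modulus p lam \<phi> f (\<tau> / lam (int n)) = epowr (osc f) (1 / p)" for f
    using p0(1) by (rule modulus_eq)
  have C: "C_const p lam \<phi> n \<tau> = epowr ?C (1 / p)"
    unfolding C_const_def ..
  have K: "K_const p lam \<phi> n \<tau> = epowr ?K (1 / p)"
    unfolding K_const_def using p0 by (simp add: best modulus epowr_SUP epowr_divide cong: SUP_cong_simp)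
  have le: "tail f \<le> ?C * osc f" if "f \<in> BS_sym p lam" for f
    using that by (intro tail_le_INF) (simp add: BS_sym_def)
  have "?K \<le> ?C"
  proof (rule SUP_least)
    fix f assume f: "f \<in> BS_sym p lam"
    then have "osc f > 0" by (intro osc_pos) (simp add: BS_sym_def)
    then show "tail f / osc f \<le> ?C"
      using le[OF f] by (intro divide_le_posI_ennreal) (simp_all add: mult.commute)
  qed
  have "(\<exists>v\<in>V \<tau>. ratio v = ?C) \<and> ?C = ?K"
  proof (cases "?K < top")
    case True
    then obtain v where v: "v \<in> V \<tau>" "ratio v \<le> ?K"
      using ratio_le_SUP by blast
    then have "?C \<le> ratio v" by (intro INF_lower)
    with v \<open>?K \<le> ?C\<close> show ?thesis by (meson antisym order_trans)
  next
    case False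
    then have top: "?K = top" unfolding less_top[symmetric] by (rule notnotD)
    with \<open>?K \<le> ?C\<close> have topC: "?C = top" by (simp only: top_unique)
    have "\<not> (\<lambda>x. x) constant_on {0..\<tau>}"
    proof
      assume "(\<lambda>x. x) constant_on {0..\<tau>}"
      then obtain c where "\<forall>x\<in>{0..\<tau>}. x = c" unfolding constant_on_def by blast
      then have "0 = c" "\<tau> = c" using \<tau> by auto
      with \<tau> show False by simp
    qed
    then have "(\<lambda>x. x) \<in> V \<tau>"
      by (auto simp: V_def mono_on_def)
    moreover have "ratio (\<lambda>x. x) = ?C"
      using INF_lower[OF calculation, of ratio] unfolding topC by (simp only: top_unique)
    ultimately show ?thesis using top topC by metis
  qed
  moreover have "best_approx p (lam (int n)) f \<le> C_const p lam \<phi> n \<tau> * modulus p lam \<phi> f (\<tau> / lam (int n))"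
    if "f \<in> BS_sym p lam" for f
    unfolding best[OF that] modulus C epowr_mult[OF p0(2), symmetric]
    using le[OF that] p0(2) by (rule epowr_mono)
  ultimately show ?thesis
    unfolding C K by auto
qed

end
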